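(* Let $A$ be a noetherian integral domain containing $\mathbb{R}$ such that $\mathbb{R}$ is algebraically closed in $A$, and suppose that $B=\mathbb{C}\otimes_{\mathbb{R}}A=A[i]$ is an integral domain. If $A$ is a UFD and $B$ is a UFD, then $\Pi(A)$ is a free abelian group, and a basis for $\Pi(A)$ is a transversal generating set $[\mathcal{T}]=\{[f]: f\in\mathcal{T}\}$, where $\mathcal{T}$ is a transversal of the action of $\Gamma$ on $\Delta(B)_1$.
   Context: For a ring $R$, $R^*$ is its unit group and $R'=R\setminus\{0\}$. Every $f\in B$ is uniquely $f=f_1+if_2$ with $f_1,f_2\in A$; its conjugate is $\bar f=f_1-if_2$. Let $K=\mathrm{frac}(A)$ and $L=\mathrm{frac}(B)=K[i]$. The polar group of $A$ is $\Pi(A)=L^*/B^*K^*$, and for $f\in B'$, $[f]$ denotes the class of $f$ in $\Pi(A)$. An element $f\in B'$ has no real divisor if $f\in rB$ with $r\in A'$ implies $r\in A^*$; $\Delta(B)$ is the set of elements of $B'$ with no real divisor, and $\Delta(B)_1$ is the set of irreducible elements of $B$ lying in $\Delta(B)$. The group $\Gamma=B^*\rtimes\mathbb{Z}_2$ acts on $B'$, with $B^*$ acting by multiplication and $\mathbb{Z}_2$ acting by $f\mapsto\bar f$; this action restricts to $\Delta(B)_1$. A transversal of this action on $\Delta(B)_1$ is a set containing exactly one element of each orbit. *)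

theory Defs
  imports
    "HOL-Algebra.Algebra"
    "HOL-Algebra.Algebraic_Closure_Type"
    "HOL-Algebra.Free_Abelian_Groups"
begin

section \<open>Fraction fields\<close>

definition frac_rel :: "('a, 'm) ring_scheme \<Rightarrow> (('a \<times> 'a) \<times> ('a \<times> 'a)) set" where
  "frac_rel R = {((a, b), (c, d)).
     a \<in> carrier R \<and> b \<in> carrier R - {\<zero>\<^bsub>R\<^esub>} \<and> c \<in> carrier R \<and> d \<in> carrier R - {\<zero>\<^bsub>R\<^esub>} \<and>
     a \<otimes>\<^bsub>R\<^esub> d = c \<otimes>\<^bsub>R\<^esub> b}"

definition fraction :: "('a, 'm) ring_scheme \<Rightarrow> 'a \<Rightarrow> 'a \<Rightarrow> ('a \<times> 'a) set" where
  "fraction R a b = frac_rel R `` {(a, b)}"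

definition frac_field :: "('a, 'm) ring_scheme \<Rightarrow> ('a \<times> 'a) set ring" where
  "frac_field R =
    \<lparr> carrier = (carrier R \<times> (carrier R - {\<zero>\<^bsub>R\<^esub>})) // frac_rel R,
      monoid.mult = (\<lambda>p q. \<Union>(a, b)\<in>p. \<Union>(c, d)\<in>q. fraction R (a \<otimes>\<^bsub>R\<^esub> c) (b \<otimes>\<^bsub>R\<^esub> d)),
      one = fraction R \<one>\<^bsub>R\<^esub> \<one>\<^bsub>R\<^esub>,
      ring.zero = fraction R \<zero>\<^bsub>R\<^esub> \<one>\<^bsub>R\<^esub>,
      add = (\<lambda>p q. \<Union>(a, b)\<in>p. \<Union>(c, d)\<in>q.
               fraction R (a \<otimes>\<^bsub>R\<^esub> d \<oplus>\<^bsub>R\<^esub> c \<otimes>\<^bsub>R\<^esub> b) (b \<otimes>\<^bsub>R\<^esub> d)) \<rparr>"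

definition frac_incl :: "('a, 'm) ring_scheme \<Rightarrow> 'a \<Rightarrow> ('a \<times> 'a) set" where
  "frac_incl R a = fraction R a \<one>\<^bsub>R\<^esub>"

text \<open>The map of fraction fields induced by an injective ring homomorphism \<open>h\<close>.\<close>

definition frac_map :: "('b, 'n) ring_scheme \<Rightarrow> ('a \<Rightarrow> 'b) \<Rightarrow> ('a \<times> 'a) set \<Rightarrow> ('b \<times> 'b) set" where
  "frac_map S h p = (\<Union>(a, b)\<in>p. fraction S (h a) (h b))"

lemma UN_pairs_const:
  assumes "(a, b) \<in> P" "(c, d) \<in> Q"
    and "\<And>a b c d. (a, b) \<in> P \<Longrightarrow> (c, d) \<in> Q \<Longrightarrow> F a b c d = V"
  shows "(\<Union>(a, b)\<in>P. \<Union>(c, d)\<in>Q. F a b c d) = V"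
proof -
  have "(\<Union>(a, b)\<in>P. \<Union>(c, d)\<in>Q. F a b c d) = (\<Union>p\<in>P. \<Union>q\<in>Q. V)"
    using assms(3) by (intro SUP_cong refl) (auto intro!: SUP_cong)
  with assms(1,2) show ?thesis by auto
qed

context domain
begin

lemma equiv_frac_rel: "equiv (carrier R \<times> (carrier R - {\<zero>})) (frac_rel R)"
proof (rule equivI)
  show "frac_rel R \<subseteq> (carrier R \<times> (carrier R - {\<zero>})) \<times> (carrier R \<times> (carrier R - {\<zero>}))"
    by (auto simp: frac_rel_def)
  show "refl_on (carrier R \<times> (carrier R - {\<zero>})) (frac_rel R)"
    by (auto simp: frac_rel_def refl_on_def)
  show "sym (frac_rel R)"
    by (auto simp: frac_rel_def sym_def)
  show "trans (frac_rel R)"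
  proof (rule transI, clarify)
    fix a b c d e f
    assume "((a, b), (c, d)) \<in> frac_rel R" "((c, d), (e, f)) \<in> frac_rel R"
    then have car: "a \<in> carrier R" "b \<in> carrier R" "b \<noteq> \<zero>" "c \<in> carrier R" "d \<in> carrier R"
        "d \<noteq> \<zero>" "e \<in> carrier R" "f \<in> carrier R" "f \<noteq> \<zero>"
      and 1: "a \<otimes> d = c \<otimes> b" and 2: "c \<otimes> f = e \<otimes> d"
      by (auto simp: frac_rel_def)
    have "d \<otimes> (a \<otimes> f) = (a \<otimes> d) \<otimes> f" using car by (simp add: m_ac)
    also have "\<dots> = (c \<otimes> f) \<otimes> b" using car 1 by (simp add: m_ac)
    also have "\<dots> = d \<otimes> (e \<otimes> b)" using car 2 by (simp add: m_ac)
    finally have "a \<otimes> f = e \<otimes> b" using car by (simp add: m_lcancel)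
    then show "((a, b), (e, f)) \<in> frac_rel R" using car by (auto simp: frac_rel_def)
  qed
qed

lemma frac_eq_iff:
  assumes "a \<in> carrier R" "b \<in> carrier R - {\<zero>}" "c \<in> carrier R" "d \<in> carrier R - {\<zero>}"
  shows "fraction R a b = fraction R c d \<longleftrightarrow> a \<otimes> d = c \<otimes> b"
proof -
  have "fraction R a b = fraction R c d \<longleftrightarrow> ((a, b), (c, d)) \<in> frac_rel R"
    unfolding fraction_def using assms by (intro eq_equiv_class_iff[OF equiv_frac_rel]) auto
  then show ?thesis using assms by (simp add: frac_rel_def)
qed

lemma frac_self: "a \<in> carrier R \<Longrightarrow> b \<in> carrier R - {\<zero>} \<Longrightarrow> (a, b) \<in> fraction R a b"
  by (auto simp: fraction_def frac_rel_def)

lemma mem_fracD: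
  assumes "(c, d) \<in> fraction R a b"
  shows "c \<in> carrier R" "d \<in> carrier R - {\<zero>}" "a \<in> carrier R" "b \<in> carrier R - {\<zero>}"
    "a \<otimes> d = c \<otimes> b"
  using assms by (auto simp: fraction_def frac_rel_def)

lemma carrier_frac_field:
  "carrier (frac_field R) = {fraction R a b | a b. a \<in> carrier R \<and> b \<in> carrier R - {\<zero>}}"
  by (force simp: frac_field_def quotient_def fraction_def)

lemma frac_closed: "a \<in> carrier R \<Longrightarrow> b \<in> carrier R - {\<zero>} \<Longrightarrow> fraction R a b \<in> carrier (frac_field R)"
  by (auto simp: carrier_frac_field)

lemma frac_mult:
  assumes "a \<in> carrier R" "b \<in> carrier R - {\<zero>}" "c \<in> carrier R" "d \<in> carrier R - {\<zero>}"
  shows "fraction R a b \<otimes>\<^bsub>frac_field R\<^esub> fraction R c d = fraction R (a \<otimes> c) (b \<otimes> d)"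
proof -
  have *: "fraction R (a' \<otimes> c') (b' \<otimes> d') = fraction R (a \<otimes> c) (b \<otimes> d)"
    if "(a', b') \<in> fraction R a b" "(c', d') \<in> fraction R c d" for a' b' c' d'
  proof -
    note m = mem_fracD[OF that(1)] mem_fracD[OF that(2)]
    have "(a' \<otimes> c') \<otimes> (b \<otimes> d) = (a' \<otimes> b) \<otimes> (c' \<otimes> d)" using m(1-4,6-9) by (simp add: m_ac)
    also have "\<dots> = (a \<otimes> b') \<otimes> (c \<otimes> d')" by (simp only: m)
    also have "\<dots> = (a \<otimes> c) \<otimes> (b' \<otimes> d')" using m(1-4,6-9) by (simp add: m_ac)
    finally show ?thesis using m by (subst frac_eq_iff) (auto simp: integral_iff)
  qed
  show ?thesis
    unfolding frac_field_def ring.simps monoid.simps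
    by (rule UN_pairs_const[OF frac_self[OF assms(1,2)] frac_self[OF assms(3,4)] *])
qed

lemma frac_add:
  assumes "a \<in> carrier R" "b \<in> carrier R - {\<zero>}" "c \<in> carrier R" "d \<in> carrier R - {\<zero>}"
  shows "fraction R a b \<oplus>\<^bsub>frac_field R\<^esub> fraction R c d = fraction R (a \<otimes> d \<oplus> c \<otimes> b) (b \<otimes> d)"
proof -
  have *: "fraction R (a' \<otimes> d' \<oplus> c' \<otimes> b') (b' \<otimes> d') = fraction R (a \<otimes> d \<oplus> c \<otimes> b) (b \<otimes> d)"
    if "(a', b') \<in> fraction R a b" "(c', d') \<in> fraction R c d" for a' b' c' d'
  proof -
    note m = mem_fracD[OF that(1)] mem_fracD[OF that(2)]
    have "(a' \<otimes> d' \<oplus> c' \<otimes> b') \<otimes> (b \<otimes> d) = (a' \<otimes> b) \<otimes> (d \<otimes> d') \<oplus> (c' \<otimes> d) \<otimes> (b \<otimes> b')"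
      using m(1-4,6-9) by (simp add: l_distr r_distr m_ac)
    also have "\<dots> = (a \<otimes> b') \<otimes> (d \<otimes> d') \<oplus> (c \<otimes> d') \<otimes> (b \<otimes> b')" by (simp only: m)
    also have "\<dots> = (a \<otimes> d \<oplus> c \<otimes> b) \<otimes> (b' \<otimes> d')"
      using m(1-4,6-9) by (simp add: l_distr r_distr m_ac)
    finally show ?thesis using m by (subst frac_eq_iff) (auto simp: integral_iff)
  qed
  show ?thesis
    unfolding frac_field_def ring.simps monoid.simps
    by (rule UN_pairs_const[OF frac_self[OF assms(1,2)] frac_self[OF assms(3,4)] *])
qed

lemma frac_field_zero: "\<zero>\<^bsub>frac_field R\<^esub> = fraction R \<zero> \<one>"
  and frac_field_one: "\<one>\<^bsub>frac_field R\<^esub> = fraction R \<one> \<one>"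
  by (simp_all add: frac_field_def)

lemma frac_field_is_field: "field (frac_field R)"
proof -
  let ?F = "frac_field R"
  have ex: "\<exists>a b. x = fraction R a b \<and> a \<in> carrier R \<and> b \<in> carrier R \<and> b \<noteq> \<zero>"
    if "x \<in> carrier ?F" for x
    using that by (auto simp: carrier_frac_field)
  have abel: "abelian_group ?F"
  proof (rule abelian_groupI)
    fix x y z assume "x \<in> carrier ?F" "y \<in> carrier ?F" "z \<in> carrier ?F"
    then show "x \<oplus>\<^bsub>?F\<^esub> y \<oplus>\<^bsub>?F\<^esub> z = x \<oplus>\<^bsub>?F\<^esub> (y \<oplus>\<^bsub>?F\<^esub> z)"
      by (auto dest!: ex simp: frac_add integral_iff l_distr r_distr a_ac m_ac)
  next
    fix x y assume "x \<in> carrier ?F" "y \<in> carrier ?F"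
    then show "x \<oplus>\<^bsub>?F\<^esub> y \<in> carrier ?F"
      by (auto dest!: ex intro!: frac_closed simp: frac_add integral_iff)
  next
    fix x y assume "x \<in> carrier ?F" "y \<in> carrier ?F"
    then show "x \<oplus>\<^bsub>?F\<^esub> y = y \<oplus>\<^bsub>?F\<^esub> x"
      by (auto dest!: ex simp: frac_add a_ac m_ac)
  next
    show "\<zero>\<^bsub>?F\<^esub> \<in> carrier ?F" by (auto simp: frac_field_zero intro!: frac_closed)
  next
    fix x assume "x \<in> carrier ?F"
    then show "\<zero>\<^bsub>?F\<^esub> \<oplus>\<^bsub>?F\<^esub> x = x"
      by (auto dest!: ex simp: frac_field_zero frac_add)
  next
    fix x assume "x \<in> carrier ?F"
    then obtain a b where x: "x = fraction R a b" "a \<in> carrier R" "b \<in> carrier R" "b \<noteq> \<zero>"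
      using ex by blast
    have "fraction R (\<ominus> a) b \<oplus>\<^bsub>?F\<^esub> x = \<zero>\<^bsub>?F\<^esub>"
      using x by (auto simp: frac_field_zero frac_add frac_eq_iff integral_iff l_minus l_neg)
    moreover have "fraction R (\<ominus> a) b \<in> carrier ?F" using x by (auto intro!: frac_closed)
    ultimately show "\<exists>y\<in>carrier ?F. y \<oplus>\<^bsub>?F\<^esub> x = \<zero>\<^bsub>?F\<^esub>" by blast
  qed
  have mon: "comm_monoid ?F"
  proof (rule comm_monoidI)
    fix x y z assume "x \<in> carrier ?F" "y \<in> carrier ?F" "z \<in> carrier ?F"
    then show "x \<otimes>\<^bsub>?F\<^esub> y \<otimes>\<^bsub>?F\<^esub> z = x \<otimes>\<^bsub>?F\<^esub> (y \<otimes>\<^bsub>?F\<^esub> z)"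
      by (auto dest!: ex simp: frac_mult integral_iff m_assoc)
  next
    fix x y assume "x \<in> carrier ?F" "y \<in> carrier ?F"
    then show "x \<otimes>\<^bsub>?F\<^esub> y \<in> carrier ?F"
      by (auto dest!: ex intro!: frac_closed simp: frac_mult integral_iff)
  next
    fix x y assume "x \<in> carrier ?F" "y \<in> carrier ?F"
    then show "x \<otimes>\<^bsub>?F\<^esub> y = y \<otimes>\<^bsub>?F\<^esub> x"
      by (auto dest!: ex simp: frac_mult m_comm)
  next
    show "\<one>\<^bsub>?F\<^esub> \<in> carrier ?F" by (auto simp: frac_field_one intro!: frac_closed)
  next
    fix x assume "x \<in> carrier ?F"
    then show "\<one>\<^bsub>?F\<^esub> \<otimes>\<^bsub>?F\<^esub> x = x"
      by (auto dest!: ex simp: frac_field_one frac_mult)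
  qed
  have "cring ?F"
  proof (rule cringI[OF abel mon])
    fix x y z assume "x \<in> carrier ?F" "y \<in> carrier ?F" "z \<in> carrier ?F"
    then obtain a b c d e f where
      x: "x = fraction R a b" "a \<in> carrier R" "b \<in> carrier R" "b \<noteq> \<zero>" and
      y: "y = fraction R c d" "c \<in> carrier R" "d \<in> carrier R" "d \<noteq> \<zero>" and
      z: "z = fraction R e f" "e \<in> carrier R" "f \<in> carrier R" "f \<noteq> \<zero>"
      using ex by meson
    then show "(x \<oplus>\<^bsub>?F\<^esub> y) \<otimes>\<^bsub>?F\<^esub> z = x \<otimes>\<^bsub>?F\<^esub> z \<oplus>\<^bsub>?F\<^esub> y \<otimes>\<^bsub>?F\<^esub> z"
      by (simp add: frac_mult frac_add integral_iff frac_eq_iff l_distr r_distr m_ac)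
  qed
  moreover have "Units ?F = carrier ?F - {\<zero>\<^bsub>?F\<^esub>}"
  proof -
    have "x \<in> Units ?F" if "x \<in> carrier ?F" "x \<noteq> \<zero>\<^bsub>?F\<^esub>" for x
    proof -
      obtain a b where x: "x = fraction R a b" "a \<in> carrier R" "b \<in> carrier R" "b \<noteq> \<zero>"
        using ex \<open>x \<in> carrier ?F\<close> by blast
      with that have a: "a \<noteq> \<zero>" by (auto simp: frac_field_zero frac_eq_iff)
      have "fraction R b a \<otimes>\<^bsub>?F\<^esub> x = \<one>\<^bsub>?F\<^esub>" "x \<otimes>\<^bsub>?F\<^esub> fraction R b a = \<one>\<^bsub>?F\<^esub>"
        using x a by (auto simp: frac_field_one frac_mult frac_eq_iff integral_iff m_comm)
      moreover have "fraction R b a \<in> carrier ?F" using x a by (auto intro!: frac_closed)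
      ultimately show ?thesis using that by (auto simp: Units_def)
    qed
    moreover have "\<zero>\<^bsub>?F\<^esub> \<notin> Units ?F"
    proof
      assume "\<zero>\<^bsub>?F\<^esub> \<in> Units ?F"
      then obtain y where "y \<in> carrier ?F" "\<zero>\<^bsub>?F\<^esub> \<otimes>\<^bsub>?F\<^esub> y = \<one>\<^bsub>?F\<^esub>"
        by (auto simp: Units_def)
      then show False
        by (auto dest!: ex simp: frac_field_zero frac_field_one frac_mult frac_eq_iff)
    qed
    ultimately show ?thesis by (auto simp: Units_def)
  qed
  ultimately show ?thesis by (rule cring.cring_fieldI)
qed

end

section \<open>The ring \<open>B = A[i]\<close>\<close>

text \<open>
  The pair \<open>(a, b)\<close> stands for \<open>a + i b\<close>. When \<open>A\<close> is an algebra over the reals this is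
  \<open>\<complex> \<otimes>\<^sub>\<real> A\<close>; lemma \<open>complexification_universal\<close> below gives its universal property as the
  coproduct of \<open>\<complex>\<close> and \<open>A\<close> among commutative rings under \<open>\<real>\<close>.
\<close>

definition complexification :: "('a, 'm) ring_scheme \<Rightarrow> ('a \<times> 'a) ring" where
  "complexification A =
    \<lparr> carrier = carrier A \<times> carrier A,
      monoid.mult = (\<lambda>(a, b) (c, d). (a \<otimes>\<^bsub>A\<^esub> c \<ominus>\<^bsub>A\<^esub> b \<otimes>\<^bsub>A\<^esub> d, a \<otimes>\<^bsub>A\<^esub> d \<oplus>\<^bsub>A\<^esub> b \<otimes>\<^bsub>A\<^esub> c)),
      one = (\<one>\<^bsub>A\<^esub>, \<zero>\<^bsub>A\<^esub>),
      ring.zero = (\<zero>\<^bsub>A\<^esub>, \<zero>\<^bsub>A\<^esub>),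
      add = (\<lambda>(a, b) (c, d). (a \<oplus>\<^bsub>A\<^esub> c, b \<oplus>\<^bsub>A\<^esub> d)) \<rparr>"

definition of_base :: "('a, 'm) ring_scheme \<Rightarrow> 'a \<Rightarrow> 'a \<times> 'a" where
  "of_base A a = (a, \<zero>\<^bsub>A\<^esub>)"

definition conjugate :: "('a, 'm) ring_scheme \<Rightarrow> 'a \<times> 'a \<Rightarrow> 'a \<times> 'a" where
  "conjugate A = (\<lambda>(a, b). (a, \<ominus>\<^bsub>A\<^esub> b))"

lemma complexification_simps [simp]:
  "carrier (complexification A) = carrier A \<times> carrier A"
  "(a, b) \<otimes>\<^bsub>complexification A\<^esub> (c, d) =
     (a \<otimes>\<^bsub>A\<^esub> c \<ominus>\<^bsub>A\<^esub> b \<otimes>\<^bsub>A\<^esub> d, a \<otimes>\<^bsub>A\<^esub> d \<oplus>\<^bsub>A\<^esub> b \<otimes>\<^bsub>A\<^esub> c)"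
  "\<one>\<^bsub>complexification A\<^esub> = (\<one>\<^bsub>A\<^esub>, \<zero>\<^bsub>A\<^esub>)"
  "\<zero>\<^bsub>complexification A\<^esub> = (\<zero>\<^bsub>A\<^esub>, \<zero>\<^bsub>A\<^esub>)"
  "(a, b) \<oplus>\<^bsub>complexification A\<^esub> (c, d) = (a \<oplus>\<^bsub>A\<^esub> c, b \<oplus>\<^bsub>A\<^esub> d)"
  by (simp_all add: complexification_def)

lemma (in cring) complexification_cring: "cring (complexification R)"
proof (rule cringI)
  let ?B = "complexification R"
  show "abelian_group ?B"
  proof (rule abelian_groupI)
    fix x assume "x \<in> carrier ?B"
    then show "\<exists>y\<in>carrier ?B. y \<oplus>\<^bsub>?B\<^esub> x = \<zero>\<^bsub>?B\<^esub>"
      by (intro bexI[of _ "(\<ominus> fst x, \<ominus> snd x)"]) (auto simp: l_neg)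
  qed (auto simp: a_ac)
  show "comm_monoid ?B"
    by (rule comm_monoidI)
       (auto simp: l_distr r_distr m_ac a_ac minus_eq l_minus r_minus minus_add)
  fix x y z assume "x \<in> carrier ?B" "y \<in> carrier ?B" "z \<in> carrier ?B"
  then show "(x \<oplus>\<^bsub>?B\<^esub> y) \<otimes>\<^bsub>?B\<^esub> z = x \<otimes>\<^bsub>?B\<^esub> z \<oplus>\<^bsub>?B\<^esub> y \<otimes>\<^bsub>?B\<^esub> z"
    by (auto simp: l_distr a_ac minus_eq minus_add)
qed

lemma (in cring) complexification_universal:
  fixes \<phi> :: "real \<Rightarrow> 'a" and S :: "('b, 'n) ring_scheme" and \<alpha> :: "complex \<Rightarrow> 'b"
  assumes \<phi>: "\<phi> \<in> ring_hom ring_of_type_algebra R" and S: "cring S"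
    and \<alpha>: "\<alpha> \<in> ring_hom ring_of_type_algebra S" and \<beta>: "\<beta> \<in> ring_hom R S"
    and agree: "\<And>r. \<alpha> (of_real r) = \<beta> (\<phi> r)"
  shows "\<exists>h \<in> ring_hom (complexification R) S.
           (\<forall>a \<in> carrier R. h (of_base R a) = \<beta> a) \<and> (\<forall>z. h (\<phi> (Re z), \<phi> (Im z)) = \<alpha> z) \<and>
           (\<forall>h' \<in> ring_hom (complexification R) S.
              (\<forall>a \<in> carrier R. h' (of_base R a) = \<beta> a) \<longrightarrow> (\<forall>z. h' (\<phi> (Re z), \<phi> (Im z)) = \<alpha> z) \<longrightarrow>
              (\<forall>f \<in> carrier (complexification R). h' f = h f))"
proof -
  let ?B = "complexification R"
  interpret S: cring S by (rule S)
  define j where "j = \<alpha> \<i>"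
  define h where "h = (\<lambda>(a, b). \<beta> a \<oplus>\<^bsub>S\<^esub> j \<otimes>\<^bsub>S\<^esub> \<beta> b)"
  have j: "j \<in> carrier S"
    using ring_hom_closed[OF \<alpha>] by (simp add: j_def ring_of_type_algebra_def)
  have phc: "\<phi> r \<in> carrier R" for r
    using ring_hom_closed[OF \<phi>] by (simp add: ring_of_type_algebra_def)
  have ph0: "\<phi> 0 = \<zero>"
    using ring_hom_zero[OF \<phi> ring_from_type_algebra ring_axioms]
    by (simp add: ring_of_type_algebra_def)
  have ph1: "\<phi> 1 = \<one>"
    using ring_hom_one[OF \<phi>] by (simp add: ring_of_type_algebra_def)
  have \<alpha>c: "\<alpha> z \<in> carrier S" and \<alpha>a: "\<alpha> (z + w) = \<alpha> z \<oplus>\<^bsub>S\<^esub> \<alpha> w"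
    and \<alpha>m: "\<alpha> (z * w) = \<alpha> z \<otimes>\<^bsub>S\<^esub> \<alpha> w" for z w
    using ring_hom_closed[OF \<alpha>, of z] ring_hom_add[OF \<alpha>, of z w] ring_hom_mult[OF \<alpha>, of z w]
    by (simp_all add: ring_of_type_algebra_def)
  have \<alpha>0: "\<alpha> 0 = \<zero>\<^bsub>S\<^esub>" and \<alpha>1: "\<alpha> 1 = \<one>\<^bsub>S\<^esub>"
    using ring_hom_zero[OF \<alpha> ring_from_type_algebra S.ring_axioms]
      ring_hom_one[OF \<alpha>]
    by (simp_all add: ring_of_type_algebra_def)
  have jj: "j \<otimes>\<^bsub>S\<^esub> j = \<ominus>\<^bsub>S\<^esub> \<one>\<^bsub>S\<^esub>"
  proof -
    have "j \<otimes>\<^bsub>S\<^esub> j \<oplus>\<^bsub>S\<^esub> \<one>\<^bsub>S\<^esub> = \<zero>\<^bsub>S\<^esub>"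
      using \<alpha>m[of \<i> \<i>] \<alpha>a[of "-1" 1] by (simp add: j_def \<alpha>0 \<alpha>1)
    then show ?thesis using j by (simp add: S.minus_equality)
  qed
  note \<beta>c = ring_hom_closed[OF \<beta>] and \<beta>a = ring_hom_add[OF \<beta>]
    and \<beta>m = ring_hom_mult[OF \<beta>] and \<beta>1 = ring_hom_one[OF \<beta>]
  have \<beta>0: "\<beta> \<zero> = \<zero>\<^bsub>S\<^esub>" by (rule ring_hom_zero[OF \<beta> ring_axioms S.ring_axioms])
  have \<beta>n: "\<beta> (\<ominus> a) = \<ominus>\<^bsub>S\<^esub> \<beta> a" if "a \<in> carrier R" for a
    using \<beta>a[of "\<ominus> a" a] that by (simp add: l_neg \<beta>0 \<beta>c S.minus_equality)
  have hom: "h \<in> ring_hom ?B S"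
  proof (rule ring_hom_memI)
    fix x y assume "x \<in> carrier ?B" "y \<in> carrier ?B"
    then obtain a b c d where x: "x = (a, b)" "a \<in> carrier R" "b \<in> carrier R"
      and y: "y = (c, d)" "c \<in> carrier R" "d \<in> carrier R" by auto
    show "h (x \<oplus>\<^bsub>?B\<^esub> y) = h x \<oplus>\<^bsub>S\<^esub> h y"
      using x y j by (simp add: h_def \<beta>a \<beta>c S.r_distr S.a_ac)
    have "h x \<otimes>\<^bsub>S\<^esub> h y = (\<beta> a \<otimes>\<^bsub>S\<^esub> \<beta> c \<oplus>\<^bsub>S\<^esub> (j \<otimes>\<^bsub>S\<^esub> j) \<otimes>\<^bsub>S\<^esub> (\<beta> b \<otimes>\<^bsub>S\<^esub> \<beta> d)) \<oplus>\<^bsub>S\<^esub>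
        j \<otimes>\<^bsub>S\<^esub> (\<beta> a \<otimes>\<^bsub>S\<^esub> \<beta> d \<oplus>\<^bsub>S\<^esub> \<beta> b \<otimes>\<^bsub>S\<^esub> \<beta> c)"
      using x y j by (simp add: h_def \<beta>c S.l_distr S.r_distr S.a_ac S.m_ac)
    also have "\<dots> = h (x \<otimes>\<^bsub>?B\<^esub> y)"
      using x y j by (simp add: h_def jj \<beta>a \<beta>c \<beta>m \<beta>n minus_eq S.l_minus)
    finally show "h (x \<otimes>\<^bsub>?B\<^esub> y) = h x \<otimes>\<^bsub>S\<^esub> h y" by simp
  qed (use j in \<open>auto simp: h_def \<beta>c \<beta>1 \<beta>0\<close>)
  have h\<beta>: "\<forall>a \<in> carrier R. h (of_base R a) = \<beta> a"
    using j by (simp add: h_def of_base_def \<beta>0 \<beta>c)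
  have h\<alpha>: "\<forall>z. h (\<phi> (Re z), \<phi> (Im z)) = \<alpha> z"
  proof
    fix z
    have "\<alpha> z = \<alpha> (of_real (Re z) + \<i> * of_real (Im z))"
      by (simp add: complex_eq[symmetric])
    then show "h (\<phi> (Re z), \<phi> (Im z)) = \<alpha> z"
      by (simp only: \<alpha>a \<alpha>m agree) (simp add: h_def j_def)
  qed
  have "h' f = h f"
    if h': "h' \<in> ring_hom ?B S" and 1: "\<forall>a \<in> carrier R. h' (of_base R a) = \<beta> a"
      and 2: "\<forall>z. h' (\<phi> (Re z), \<phi> (Im z)) = \<alpha> z" and f: "f \<in> carrier ?B" for h' f
  proof -
    obtain a b where ab: "f = (a, b)" "a \<in> carrier R" "b \<in> carrier R" using f by auto
    have "f = of_base R a \<oplus>\<^bsub>?B\<^esub> (\<phi> (Re \<i>), \<phi> (Im \<i>)) \<otimes>\<^bsub>?B\<^esub> of_base R b"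
      using ab by (simp add: of_base_def ph0 ph1 minus_eq)
    also have "h' \<dots> = \<beta> a \<oplus>\<^bsub>S\<^esub> j \<otimes>\<^bsub>S\<^esub> \<beta> b"
    proof -
      have i: "(\<phi> (Re \<i>), \<phi> (Im \<i>)) \<in> carrier ?B" using phc by simp
      have m: "(\<phi> (Re \<i>), \<phi> (Im \<i>)) \<otimes>\<^bsub>?B\<^esub> of_base R b \<in> carrier ?B"
        using ab phc by (simp add: of_base_def)
      have a: "of_base R a \<in> carrier ?B" and b: "of_base R b \<in> carrier ?B"
        using ab by (simp_all add: of_base_def)
      show ?thesis
        unfolding ring_hom_add[OF h' a m] ring_hom_mult[OF h' i b] 2[rule_format] j_def
        using 1 ab by simp
    qed
    finally show ?thesis by (simp add: ab h_def)
  qed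
  with hom h\<beta> h\<alpha> show ?thesis by blast
qed

lemma frac_map_fraction:
  assumes "domain A" "domain (complexification A)"
    and "a \<in> carrier A" "b \<in> carrier A - {\<zero>\<^bsub>A\<^esub>}"
  shows "frac_map (complexification A) (of_base A) (fraction A a b) =
           fraction (complexification A) (of_base A a) (of_base A b)"
proof -
  interpret A: domain A by fact
  interpret B: domain "complexification A" by fact
  have "fraction (complexification A) (of_base A a') (of_base A b') =
        fraction (complexification A) (of_base A a) (of_base A b)"
    if "(a', b') \<in> fraction A a b" for a' b'
    using A.mem_fracD[OF that]
    by (subst B.frac_eq_iff) (auto simp: of_base_def A.minus_eq)
  then have "frac_map (complexification A) (of_base A) (fraction A a b) =
      (\<Union>p \<in> fraction A a b. fraction (complexification A) (of_base A a) (of_base A b))"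
    unfolding frac_map_def by (intro SUP_cong) auto
  then show ?thesis
    using A.frac_self[OF assms(3,4)] by auto
qed

section \<open>The polar group\<close>

text \<open>The subgroup \<open>B\<^sup>*K\<^sup>*\<close> of \<open>L\<^sup>*\<close>, with \<open>K\<close> regarded as a subfield of \<open>L\<close>.\<close>

definition polar_subgroup :: "('a, 'm) ring_scheme \<Rightarrow> (('a \<times> 'a) \<times> ('a \<times> 'a)) set set" where
  "polar_subgroup A =
     (let B = complexification A; L = frac_field B; K = frac_field A
      in (frac_incl B ` Units B) <#>\<^bsub>units_of L\<^esub> (frac_map B (of_base A) ` Units K))"

definition polar_group :: "('a, 'm) ring_scheme \<Rightarrow> (('a \<times> 'a) \<times> ('a \<times> 'a)) set set monoid" where
  "polar_group A = units_of (frac_field (complexification A)) Mod polar_subgroup A"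

definition polar_class :: "('a, 'm) ring_scheme \<Rightarrow> 'a \<times> 'a \<Rightarrow> (('a \<times> 'a) \<times> ('a \<times> 'a)) set set" where
  "polar_class A f =
     (let B = complexification A
      in polar_subgroup A #>\<^bsub>units_of (frac_field B)\<^esub> frac_incl B f)"

section \<open>Elements with no real divisor and the action of \<open>\<Gamma>\<close>\<close>

definition no_real_divisor :: "('a, 'm) ring_scheme \<Rightarrow> 'a \<times> 'a \<Rightarrow> bool" where
  "no_real_divisor A f \<longleftrightarrow>
     (\<forall>r \<in> carrier A - {\<zero>\<^bsub>A\<^esub>}. f \<in> PIdl\<^bsub>complexification A\<^esub> (of_base A r) \<longrightarrow> r \<in> Units A)"

definition Delta :: "('a, 'm) ring_scheme \<Rightarrow> ('a \<times> 'a) set" where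
  "Delta A = {f \<in> carrier (complexification A) - {\<zero>\<^bsub>complexification A\<^esub>}. no_real_divisor A f}"

definition Delta1 :: "('a, 'm) ring_scheme \<Rightarrow> ('a \<times> 'a) set" where
  "Delta1 A = {f \<in> Delta A. ring_irreducible\<^bsub>complexification A\<^esub> f}"

text \<open>The action of \<open>\<int>\<^sub>2 = {0, 1}\<close> on \<open>B\<close>, and in particular on \<open>B\<^sup>*\<close>, by conjugation.\<close>

definition conj_pow :: "('a, 'm) ring_scheme \<Rightarrow> int \<Rightarrow> 'a \<times> 'a \<Rightarrow> 'a \<times> 'a" where
  "conj_pow A s f = (if s = 0 then f else conjugate A f)"

definition Gamma :: "('a, 'm) ring_scheme \<Rightarrow> (('a \<times> 'a) \<times> int) monoid" where
  "Gamma A =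
    \<lparr> carrier = Units (complexification A) \<times> carrier (integer_mod_group 2),
      monoid.mult = (\<lambda>(u, s) (v, t).
        (u \<otimes>\<^bsub>complexification A\<^esub> conj_pow A s v, s \<otimes>\<^bsub>integer_mod_group 2\<^esub> t)),
      one = (\<one>\<^bsub>complexification A\<^esub>, \<one>\<^bsub>integer_mod_group 2\<^esub>) \<rparr>"

definition Gamma_act :: "('a, 'm) ring_scheme \<Rightarrow> ('a \<times> 'a) \<times> int \<Rightarrow> 'a \<times> 'a \<Rightarrow> 'a \<times> 'a" where
  "Gamma_act A = (\<lambda>(u, s).
     \<lambda>f \<in> carrier (complexification A) - {\<zero>\<^bsub>complexification A\<^esub>}.
       u \<otimes>\<^bsub>complexification A\<^esub> conj_pow A s f)"

definition is_transversal :: "('a, 'm) ring_scheme \<Rightarrow> ('a \<times> 'a) set \<Rightarrow> bool" where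
  "is_transversal A T \<longleftrightarrow>
     T \<subseteq> Delta1 A \<and> (\<forall>W \<in> orbits (Gamma A) (Delta1 A) (Gamma_act A). \<exists>!f. f \<in> T \<inter> W)"

context cring
begin

lemma conj_pow_hom: "conj_pow R s \<in> ring_hom (complexification R) (complexification R)"
  by (rule ring_hom_memI)
     (auto simp: conj_pow_def conjugate_def minus_eq minus_add l_minus r_minus)

lemma conj_pow_conj_pow:
  assumes "s \<in> {0, 1}" "t \<in> {0, 1}" "f \<in> carrier (complexification R)"
  shows "conj_pow R s (conj_pow R t f) = conj_pow R ((s + t) mod 2) f"
  using assms by (auto simp: conj_pow_def conjugate_def)

lemma conj_pow_closed:
  "f \<in> carrier (complexification R) \<Longrightarrow> conj_pow R s f \<in> carrier (complexification R)"
  by (rule ring_hom_closed[OF conj_pow_hom])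

lemma conj_pow_Units:
  assumes "u \<in> Units (complexification R)"
  shows "conj_pow R s u \<in> Units (complexification R)"
proof -
  let ?B = "complexification R"
  obtain v where v: "u \<in> carrier ?B" "v \<in> carrier ?B" "v \<otimes>\<^bsub>?B\<^esub> u = \<one>\<^bsub>?B\<^esub>" "u \<otimes>\<^bsub>?B\<^esub> v = \<one>\<^bsub>?B\<^esub>"
    using assms unfolding Units_def by blast
  note * = ring_hom_mult[OF conj_pow_hom, symmetric] ring_hom_one[OF conj_pow_hom]
  have "conj_pow R s v \<otimes>\<^bsub>?B\<^esub> conj_pow R s u = \<one>\<^bsub>?B\<^esub>"
    "conj_pow R s u \<otimes>\<^bsub>?B\<^esub> conj_pow R s v = \<one>\<^bsub>?B\<^esub>"
    using v by (simp_all only: *)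
  then show ?thesis using v conj_pow_closed unfolding Units_def by blast
qed

lemma Gamma_simps:
  "carrier (Gamma R) = Units (complexification R) \<times> {0, 1}"
  "(u, s) \<otimes>\<^bsub>Gamma R\<^esub> (v, t) = (u \<otimes>\<^bsub>complexification R\<^esub> conj_pow R s v, (s + t) mod 2)"
  "\<one>\<^bsub>Gamma R\<^esub> = (\<one>\<^bsub>complexification R\<^esub>, 0)"
  by (auto simp: Gamma_def carrier_integer_mod_group)

lemma group_Gamma: "group (Gamma R)"
proof (rule groupI)
  let ?B = "complexification R"
  interpret B: cring ?B by (rule complexification_cring)
  note [simp del] = complexification_simps
  note hm = ring_hom_mult[OF conj_pow_hom]
  {
    fix x y assume "x \<in> carrier (Gamma R)" "y \<in> carrier (Gamma R)"
    then show "x \<otimes>\<^bsub>Gamma R\<^esub> y \<in> carrier (Gamma R)"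
      by (auto simp: Gamma_simps conj_pow_Units)
  next
    show "\<one>\<^bsub>Gamma R\<^esub> \<in> carrier (Gamma R)" by (simp add: Gamma_simps)
  next
    fix x y z assume xyz: "x \<in> carrier (Gamma R)" "y \<in> carrier (Gamma R)" "z \<in> carrier (Gamma R)"
    obtain u s v t w r where [simp]: "x = (u, s)" "y = (v, t)" "z = (w, r)"
      by (cases x, cases y, cases z)
    have "u \<in> Units ?B" "v \<in> Units ?B" "w \<in> Units ?B" "s \<in> {0, 1}" "t \<in> {0, 1}"
      using xyz by (simp_all add: Gamma_simps)
    then show "x \<otimes>\<^bsub>Gamma R\<^esub> y \<otimes>\<^bsub>Gamma R\<^esub> z = x \<otimes>\<^bsub>Gamma R\<^esub> (y \<otimes>\<^bsub>Gamma R\<^esub> z)"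
      by (simp add: Gamma_simps hm conj_pow_conj_pow conj_pow_closed B.Units_closed B.m_assoc
          mod_add_left_eq mod_add_right_eq add.assoc del: insert_iff)
  next
    fix x assume x: "x \<in> carrier (Gamma R)"
    then show "\<one>\<^bsub>Gamma R\<^esub> \<otimes>\<^bsub>Gamma R\<^esub> x = x"
      by (auto simp: Gamma_simps conj_pow_def)
    obtain u s where [simp]: "x = (u, s)" by (cases x)
    have u: "u \<in> Units ?B" and s: "s \<in> {0, 1}" using x by (simp_all add: Gamma_simps)
    define v where "v = conj_pow R s (inv\<^bsub>?B\<^esub> u)"
    have "v \<otimes>\<^bsub>?B\<^esub> conj_pow R s u = conj_pow R s \<one>\<^bsub>?B\<^esub>"
      unfolding v_def using u by (subst hm[symmetric]) auto
    also have "\<dots> = \<one>\<^bsub>?B\<^esub>" by (rule ring_hom_one[OF conj_pow_hom])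
    finally have "(v, s) \<otimes>\<^bsub>Gamma R\<^esub> x = \<one>\<^bsub>Gamma R\<^esub>"
      using s by (auto simp: Gamma_simps)
    moreover have "(v, s) \<in> carrier (Gamma R)"
      using u s by (simp add: Gamma_simps v_def conj_pow_Units)
    ultimately show "\<exists>y\<in>carrier (Gamma R). y \<otimes>\<^bsub>Gamma R\<^esub> x = \<one>\<^bsub>Gamma R\<^esub>" by blast
  }
qed

lemma group_action_Gamma:
  "group_action (Gamma R) (carrier (complexification R) - {\<zero>\<^bsub>complexification R\<^esub>}) (Gamma_act R)"
proof -
  let ?B = "complexification R"
  let ?E = "carrier ?B - {\<zero>\<^bsub>?B\<^esub>}"
  interpret B: cring ?B by (rule complexification_cring)
  interpret G: group "Gamma R" by (rule group_Gamma)
  note [simp del] = complexification_simps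
  note hm = ring_hom_mult[OF conj_pow_hom]
  let ?a = "\<lambda>g f. fst g \<otimes>\<^bsub>?B\<^esub> conj_pow R (snd g) f"
  have act: "Gamma_act R g f = ?a g f" if "f \<in> ?E" for g f
    using that by (simp add: Gamma_act_def split_beta)
  have car: "?a g f \<in> carrier ?B" if "g \<in> carrier (Gamma R)" "f \<in> carrier ?B" for g f
    using that by (auto simp: Gamma_simps conj_pow_closed B.Units_closed)
  have one: "?a \<one>\<^bsub>Gamma R\<^esub> f = f" if "f \<in> carrier ?B" for f
    using that by (simp add: Gamma_simps conj_pow_def)
  have comp: "?a (g \<otimes>\<^bsub>Gamma R\<^esub> k) f = ?a g (?a k f)"
    if gk: "g \<in> carrier (Gamma R)" "k \<in> carrier (Gamma R)" and f: "f \<in> carrier ?B" for g k f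
  proof -
    obtain u s v t where [simp]: "g = (u, s)" "k = (v, t)" by (cases g, cases k)
    have "u \<in> Units ?B" "v \<in> Units ?B" "s \<in> {0, 1}" "t \<in> {0, 1}"
      using gk by (simp_all add: Gamma_simps)
    then show ?thesis using f
      by (simp add: Gamma_simps hm conj_pow_conj_pow conj_pow_closed B.Units_closed B.m_assoc
          del: insert_iff)
  qed
  have zero: "?a g \<zero>\<^bsub>?B\<^esub> = \<zero>\<^bsub>?B\<^esub>" if "g \<in> carrier (Gamma R)" for g
    using that ring_hom_zero[OF conj_pow_hom B.ring_axioms B.ring_axioms]
    by (auto simp: Gamma_simps B.Units_closed)
  have inv: "?a (inv\<^bsub>Gamma R\<^esub> g) (?a g f) = f" "?a g (?a (inv\<^bsub>Gamma R\<^esub> g) f) = f"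
    if "g \<in> carrier (Gamma R)" "f \<in> carrier ?B" for g f
    using that comp[symmetric] one by simp_all
  have E: "?a g f \<in> ?E" if g: "g \<in> carrier (Gamma R)" and f: "f \<in> ?E" for g f
  proof -
    have "?a g f \<noteq> \<zero>\<^bsub>?B\<^esub>"
    proof
      assume "?a g f = \<zero>\<^bsub>?B\<^esub>"
      then have "f = \<zero>\<^bsub>?B\<^esub>"
        using inv(1)[of g f] zero[of "inv\<^bsub>Gamma R\<^esub> g"] g f by simp
      then show False using f by simp
    qed
    with car[OF g] f show ?thesis by simp
  qed
  have ext: "Gamma_act R g \<in> extensional ?E" for g
    by (simp add: Gamma_act_def split_beta)
  have bij: "Gamma_act R g \<in> Bij ?E" if g: "g \<in> carrier (Gamma R)" for g
  proof -
    have "bij_betw (Gamma_act R g) ?E ?E"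
    proof (rule bij_betwI[where g = "Gamma_act R (inv\<^bsub>Gamma R\<^esub> g)"])
      show "Gamma_act R g \<in> ?E \<rightarrow> ?E" "Gamma_act R (inv\<^bsub>Gamma R\<^esub> g) \<in> ?E \<rightarrow> ?E"
        using E[OF g] E[OF G.inv_closed[OF g]] by (simp_all add: act)
    qed (use E[OF g] E[OF G.inv_closed[OF g]] inv[OF g] in \<open>simp_all add: act\<close>)
    with ext show ?thesis by (simp add: Bij_def)
  qed
  have "Gamma_act R \<in> hom (Gamma R) (BijGroup ?E)"
  proof (rule homI)
    fix g k assume gk: "g \<in> carrier (Gamma R)" "k \<in> carrier (Gamma R)"
    have "Gamma_act R (g \<otimes>\<^bsub>Gamma R\<^esub> k) = compose ?E (Gamma_act R g) (Gamma_act R k)"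
    proof (rule extensionalityI)
      show "Gamma_act R (g \<otimes>\<^bsub>Gamma R\<^esub> k) \<in> extensional ?E" by (rule ext)
      show "compose ?E (Gamma_act R g) (Gamma_act R k) \<in> extensional ?E"
        by (rule compose_extensional)
      fix f assume f: "f \<in> ?E"
      show "Gamma_act R (g \<otimes>\<^bsub>Gamma R\<^esub> k) f = compose ?E (Gamma_act R g) (Gamma_act R k) f"
        unfolding compose_eq[OF f] act[OF f] act[OF E[OF gk(2) f]]
        using f by (intro comp[OF gk]) simp
    qed
    then show "Gamma_act R (g \<otimes>\<^bsub>Gamma R\<^esub> k) = Gamma_act R g \<otimes>\<^bsub>BijGroup ?E\<^esub> Gamma_act R k"
      by (simp only: BijGroup_def monoid.simps restrict_apply' bij[OF gk(1)] bij[OF gk(2)])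
  qed (simp add: BijGroup_def bij)
  then show ?thesis
    by (simp add: group_action_def group_hom_def group_hom_axioms_def group_BijGroup group_Gamma)
qed

lemma ex_transversal: "\<exists>T. is_transversal R T"
proof -
  interpret group_action "Gamma R" "carrier (complexification R) - {\<zero>\<^bsub>complexification R\<^esub>}" "Gamma_act R"
    by (rule group_action_Gamma)
  let ?O = "orbits (Gamma R) (Delta1 R) (Gamma_act R)"
  have DE: "Delta1 R \<subseteq> carrier (complexification R) - {\<zero>\<^bsub>complexification R\<^esub>}"
    by (auto simp: Delta1_def Delta_def)
  have "\<exists>f. f \<in> Delta1 R \<inter> W" if "W \<in> ?O" for W
    using that DE orbit_refl unfolding orbits_def by blast
  then obtain r where r: "\<And>W. W \<in> ?O \<Longrightarrow> r W \<in> Delta1 R \<inter> W" by metis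
  have disj: "V = W" if "V \<in> ?O" "W \<in> ?O" "f \<in> V" "f \<in> W" for V W f
  proof -
    have "V \<in> orbits (Gamma R) (carrier (complexification R) - {\<zero>\<^bsub>complexification R\<^esub>}) (Gamma_act R)"
      "W \<in> orbits (Gamma R) (carrier (complexification R) - {\<zero>\<^bsub>complexification R\<^esub>}) (Gamma_act R)"
      using that(1,2) DE unfolding orbits_def by blast+
    then show ?thesis using disjoint_union that(3,4) by blast
  qed
  have "is_transversal R (r ` ?O)"
    unfolding is_transversal_def using r disj by blast
  then show ?thesis ..
qed

end

section \<open>Free abelian groups\<close>

text \<open>
  \<open>S\<close> is a basis of \<open>G\<close> if every element of \<open>G\<close> is \<open>\<Prod> s\<^bsup>c(s)\<^esup>\<close> for exactly one finitely
  supported \<open>c : S \<rightarrow> \<int>\<close>. Such \<open>c\<close> form the carrier of \<open>free_Abelian_group S\<close>.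
\<close>

definition is_basis :: "('g, 'm) monoid_scheme \<Rightarrow> 'g set \<Rightarrow> bool" where
  "is_basis G S \<longleftrightarrow> S \<subseteq> carrier G \<and>
     (\<forall>x \<in> carrier G. \<exists>!c. c \<in> carrier (free_Abelian_group S) \<and>
        x = (\<Otimes>\<^bsub>G\<^esub>s\<in>Poly_Mapping.keys c. s [^]\<^bsub>G\<^esub> Poly_Mapping.lookup c s))"

definition free_abelian :: "('g, 'm) monoid_scheme \<Rightarrow> bool" where
  "free_abelian G \<longleftrightarrow> comm_group G \<and> (\<exists>S. is_basis G S)"

end

theory Submission
  imports Defs
begin

text \<open>
  For a prime \<open>t\<close> of \<open>B\<close> let \<open>v\<^sub>t\<close> be the \<open>t\<close>-adic valuation. The homomorphism \<open>v\<^sub>t - v\<^sub>s\<close>, with \<open>s\<close> the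
  conjugate of \<open>t\<close>, vanishes on \<open>B\<^sup>*\<close> and, being antisymmetric under conjugation, on \<open>K\<^sup>*\<close>, so it
  descends to \<open>\<Pi>(A)\<close>. A prime without real divisor is not associated to its conjugate, hence on the
  classes of a transversal these homomorphisms form a dual system, which gives independence. For
  generation, factor into primes: a prime with a nontrivial real divisor is a unit times a real
  element and has trivial class, and conjugate elements have inverse classes since the norm is real.
\<close>

section \<open>Valuations of a factorial monoid\<close>

text \<open>The number of factors associated to \<open>p\<close> in an arbitrarily chosen
  irreducible factorization of \<open>a\<close>: \<open>fmset\<close> is the multiset of association
  classes of the factors. Independence of the choice is
  \<open>prime_valuation_wfactors\<close>.\<close>

definition prime_valuation :: "('a, 'm) monoid_scheme \<Rightarrow> 'a \<Rightarrow> 'a \<Rightarrow> nat" where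
  "prime_valuation G p a =
     count (fmset G (SOME as. set as \<subseteq> carrier G \<and> wfactors G as a)) (assocs G p)"

context factorial_monoid
begin

text \<open>Every element is a unit times the product of its irreducible factors, so a property
  stable under products only has to be checked on units and on irreducibles.\<close>

lemma factorial_induct [consumes 1, case_names unit irreducible mult]:
  assumes a: "a \<in> carrier G"
    and unit: "\<And>u. u \<in> Units G \<Longrightarrow> P u"
    and irr: "\<And>q. q \<in> carrier G \<Longrightarrow> irreducible G q \<Longrightarrow> P q"
    and mult: "\<And>x y. x \<in> carrier G \<Longrightarrow> y \<in> carrier G \<Longrightarrow> P x \<Longrightarrow> P y \<Longrightarrow> P (x \<otimes> y)"
  shows "P a"
proof -
  obtain as where as: "set as \<subseteq> carrier G" "wfactors G as a" using wfactors_exist a by blast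
  have irrs: "\<forall>q \<in> set as. irreducible G q" and assoc: "foldr (\<otimes>) as \<one> \<sim> a"
    using as(2) by (auto simp: wfactors_def)
  have 1: "P (foldr (\<otimes>) as \<one>) \<and> foldr (\<otimes>) as \<one> \<in> carrier G"
    using as(1) irrs by (induction as) (auto intro: unit irr mult)
  obtain u where u: "u \<in> Units G" "a = foldr (\<otimes>) as \<one> \<otimes> u"
    using associatedE2[OF associated_sym[OF assoc] _ a] 1 by blast
  show ?thesis unfolding u(2) using 1 u(1) by (intro mult) (auto intro: unit)
qed

text \<open>Uniqueness of factorization up to order and associates makes the choice hidden in
  \<open>SOME\<close> irrelevant; from here on any convenient factorization computes the
  valuation.\<close>

lemma prime_valuation_wfactors:
  assumes "a \<in> carrier G" "set as \<subseteq> carrier G" "wfactors G as a"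
  shows "prime_valuation G p a = count (fmset G as) (assocs G p)"
proof -
  define bs where "bs = (SOME as. set as \<subseteq> carrier G \<and> wfactors G as a)"
  have bs: "set bs \<subseteq> carrier G \<and> wfactors G bs a"
    unfolding bs_def using assms by (intro someI_ex[of "\<lambda>as. set as \<subseteq> carrier G \<and> wfactors G as a"]) auto
  have "fmset G bs = fmset G as"
    using wfactors_unique bs assms by (intro ee_fmset) auto
  then show ?thesis by (simp add: prime_valuation_def bs_def)
qed

lemma prime_valuation_mult:
  assumes "a \<in> carrier G" "b \<in> carrier G"
  shows "prime_valuation G p (a \<otimes> b) = prime_valuation G p a + prime_valuation G p b"
proof -
  obtain as bs cs where
    f: "set as \<subseteq> carrier G" "wfactors G as a" "set bs \<subseteq> carrier G" "wfactors G bs b"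
      "set cs \<subseteq> carrier G" "wfactors G cs (a \<otimes> b)"
    using wfactors_exist assms m_closed by meson
  have "fmset G cs = fmset G as + fmset G bs"
    by (rule mult_wfactors_fmset[OF f(2,4,6) assms f(1,3,5)])
  then show ?thesis
    using f assms by (simp add: prime_valuation_wfactors)
qed

lemma prime_valuation_Units:
  assumes "u \<in> Units G"
  shows "prime_valuation G p u = 0"
  \<comment> \<open>The empty list is a factorization of a unit.\<close>
  using assms prime_valuation_wfactors[of u "[]"] unit_wfactors[of u]
  by (simp add: fmset_def Units_closed)

lemma prime_valuation_irreducible:
  assumes "p \<in> carrier G" "q \<in> carrier G" "irreducible G q"
  shows "prime_valuation G p q = (if q \<sim> p then 1 else 0)"
proof -
  have "wfactors G [q] q" using assms by (intro wfactorsI) auto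
  then have "prime_valuation G p q = (if assocs G q = assocs G p then 1 else 0)"
    using prime_valuation_wfactors[of q "[q]"] assms by (simp add: fmset_def)
  moreover have "q \<sim> p" if "assocs G q = assocs G p"
    using assocs_eqD[OF that] assms by (simp add: associated_sym)
  moreover have "assocs G q = assocs G p" if "q \<sim> p"
    using eqc_listassoc_cong[of "[q]" "[p]"] that assms by simp
  ultimately show ?thesis by auto
qed

end

section \<open>Bases of abelian groups\<close>

text \<open>Generation gives existence of exponents. For uniqueness, the homomorphism dual to
  \<open>s\<close> sends a product of powers to the exponent of \<open>s\<close>, so the element
  determines all its exponents.\<close>

lemma (in comm_group) is_basisI:
  assumes S: "S \<subseteq> carrier G" and gen: "carrier G \<subseteq> generate G S"
    and dual: "\<And>s. s \<in> S \<Longrightarrow>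
      \<exists>w \<in> hom G integer_group. \<forall>s' \<in> S. w s' = (if s' = s then 1 else 0)"
  shows "is_basis G S"
proof -
  define h where "h = (\<lambda>c. \<Otimes>s\<in>Poly_Mapping.keys c. s [^] (Poly_Mapping.lookup c s :: int))"
  \<comment> \<open>Enlarging the index set only adds factors with exponent 0. This allows products
    for different \<open>c\<close> to be compared over one common index set.\<close>
  have h_superset: "h c = (\<Otimes>s\<in>K. s [^] Poly_Mapping.lookup c s)"
    if "finite K" "Poly_Mapping.keys c \<subseteq> K" "K \<subseteq> S" for c K
    unfolding h_def using that S
    by (intro finprod_mono_neutral_cong_left) (auto simp: in_keys_iff)
  have h_add: "h (c + d) = h c \<otimes> h d"
    if "Poly_Mapping.keys c \<subseteq> S" "Poly_Mapping.keys d \<subseteq> S" for c d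
  proof -
    \<comment> \<open>Cancellation can make the support of \<open>c + d\<close> smaller than this
      union, so all three products are taken over the union.\<close>
    define K where "K = Poly_Mapping.keys c \<union> Poly_Mapping.keys d"
    have K: "finite K" "K \<subseteq> S" and c: "Poly_Mapping.keys c \<subseteq> K"
      and d: "Poly_Mapping.keys d \<subseteq> K" and cd: "Poly_Mapping.keys (c + d) \<subseteq> K"
      using that keys_add[of c d] by (auto simp: K_def)
    have clo: "(\<lambda>s. s [^] (e s :: int)) \<in> K \<rightarrow> carrier G" for e using K S by auto
    have "h (c + d) = (\<Otimes>s\<in>K. s [^] Poly_Mapping.lookup c s \<otimes> s [^] Poly_Mapping.lookup d s)"
      unfolding h_superset[OF K(1) cd K(2)] using K(2) S
      by (intro finprod_cong') (auto simp: Poly_Mapping.lookup_add int_pow_mult)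
    also have "\<dots> = h c \<otimes> h d"
      unfolding h_superset[OF K(1) c K(2)] h_superset[OF K(1) d K(2)]
      by (rule finprod_multf[OF clo clo])
    finally show ?thesis .
  qed
  have h_of: "h (frag_cmul k (frag_of s)) = s [^] k" if "s \<in> S" for s and k :: int
    using that S h_superset[of "{s}" "frag_cmul k (frag_of s)"] keys_cmul[of k "frag_of s"]
    by (auto simp: finprod_singleton subset_iff)
  have surj: "\<exists>c. Poly_Mapping.keys c \<subseteq> S \<and> x = h c" if "x \<in> generate G S" for x
    using that
  proof induction
    case one
    then show ?case by (intro exI[of _ 0]) (simp add: h_def)
  next
    case (incl s)
    then show ?case using S h_of[of s 1]
      by (intro exI[of _ "frag_of s"]) auto
  next
    case (inv s)
    then show ?case using S h_of[of s "-1"]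
      by (intro exI[of _ "frag_cmul (-1) (frag_of s)"]) (auto simp: int_pow_neg)
  next
    case (eng x y)
    then obtain c d where "Poly_Mapping.keys c \<subseteq> S" "x = h c" "Poly_Mapping.keys d \<subseteq> S" "y = h d"
      by blast
    then show ?case using keys_add[of c d] h_add
      by (intro exI[of _ "c + d"]) auto
  qed
  have coeff: "Poly_Mapping.lookup c s = w (h c)"
    if c: "Poly_Mapping.keys c \<subseteq> S" and s: "s \<in> S" and w: "w \<in> hom G integer_group"
      "\<forall>s' \<in> S. w s' = (if s' = s then 1 else 0)" for c s w
  proof -
    interpret w: group_hom G integer_group w
      using w(1) is_group by (simp add: group_hom_def group_hom_axioms_def)
    have "w (h c) = (\<Sum>s' \<in> K. Poly_Mapping.lookup c s' * (if s' = s then 1 else 0))"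
      if "finite K" "Poly_Mapping.keys c \<subseteq> K" "K \<subseteq> S" for K
    proof -
      have "w (\<Otimes>s\<in>K. s [^] Poly_Mapping.lookup c s) =
          (\<Sum>s' \<in> K. Poly_Mapping.lookup c s' * (if s' = s then 1 else 0))"
        using that(1,3)
      proof (induction K)
        case (insert t K)
        then have "w ((t [^] Poly_Mapping.lookup c t) \<otimes> (\<Otimes>s\<in>K. s [^] Poly_Mapping.lookup c s)) =
          w (t [^] Poly_Mapping.lookup c t) + w (\<Otimes>s\<in>K. s [^] Poly_Mapping.lookup c s)"
          using S by (subst w.hom_mult) (auto intro!: finprod_closed)
        then show ?case using insert S w(2)
          by (subst finprod_insert) (auto simp: w.hom_int_pow)
      qed (use w.hom_one in simp)
      then show ?thesis using that h_superset by simp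
    qed
    \<comment> \<open>Inserting \<open>s\<close> covers the case where its coefficient is 0 and
      \<open>s\<close> is missing from the support.\<close>
    from this[of "insert s (Poly_Mapping.keys c)"] c s show ?thesis
      by (simp add: sum.delta if_distrib subset_insertI cong: if_cong)
  qed
  have inj: "c = d" if "Poly_Mapping.keys c \<subseteq> S" "Poly_Mapping.keys d \<subseteq> S" "h c = h d" for c d
  proof (rule poly_mapping_eqI)
    fix s show "Poly_Mapping.lookup c s = Poly_Mapping.lookup d s"
    proof (cases "s \<in> S")
      case True
      with dual obtain w where "w \<in> hom G integer_group" "\<forall>s' \<in> S. w s' = (if s' = s then 1 else 0)"
        by blast
      then show ?thesis using coeff[of c s w] coeff[of d s w] True that by simp
    next
      case False
      then have "s \<notin> Poly_Mapping.keys c" "s \<notin> Poly_Mapping.keys d" using that by auto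
      then show ?thesis by (simp add: in_keys_iff)
    qed
  qed
  show ?thesis
    unfolding is_basis_def carrier_free_Abelian_group_iff
  proof (intro conjI ballI S)
    fix x assume "x \<in> carrier G"
    then obtain c where c: "Poly_Mapping.keys c \<subseteq> S" "x = h c" using gen surj by blast
    then have "\<exists>!c. Poly_Mapping.keys c \<subseteq> S \<and> x = h c"
      using inj by (intro ex1I[of _ c]) auto
    then show "\<exists>!c. Poly_Mapping.keys c \<subseteq> S \<and>
        x = (\<Otimes>s\<in>Poly_Mapping.keys c. s [^] (Poly_Mapping.lookup c s :: int))"
      unfolding h_def .
  qed
qed

section \<open>Extending homomorphisms to the fraction field\<close>

text \<open>The extension of \<open>w\<close> to nonzero fractions, sending a/b to
  \<open>w a - w b\<close>. The description ranges over all representatives, so it is meaningful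
  only once the value is shown not to depend on them.\<close>

definition frac_extend :: "('a, 'm) ring_scheme \<Rightarrow> ('a \<Rightarrow> int) \<Rightarrow> ('a \<times> 'a) set \<Rightarrow> int" where
  "frac_extend R w x =
     (THE k. \<exists>a \<in> carrier (mult_of R). \<exists>b \<in> carrier (mult_of R). x = fraction R a b \<and> k = w a - w b)"

context domain
begin

lemma Units_frac_field:
  "Units (frac_field R) =
     {fraction R a b | a b. a \<in> carrier R - {\<zero>} \<and> b \<in> carrier R - {\<zero>}}"
proof -
  have "fraction R a b = \<zero>\<^bsub>frac_field R\<^esub> \<longleftrightarrow> a = \<zero>" if "a \<in> carrier R" "b \<in> carrier R - {\<zero>}" for a b
    using that frac_eq_iff[of a b \<zero> \<one>] by (simp add: frac_field_zero)
  then show ?thesis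
    unfolding field.field_Units[OF frac_field_is_field] carrier_frac_field by blast
qed

text \<open>Equality of fractions is equality of cross products, which \<open>w\<close> turns into
  an equality of sums; hence the difference is the same for every representative.\<close>

lemma frac_extend_fraction:
  assumes w: "w \<in> hom (mult_of R) integer_group"
    and ab: "a \<in> carrier (mult_of R)" "b \<in> carrier (mult_of R)"
  shows "frac_extend R w (fraction R a b) = w a - w b"
proof -
  have "w c - w d = w a - w b"
    if "c \<in> carrier (mult_of R)" "d \<in> carrier (mult_of R)" "fraction R a b = fraction R c d" for c d
  proof -
    have "a \<otimes> d = c \<otimes> b" using that ab by (simp add: frac_eq_iff)
    then have "w a + w d = w c + w b"
      using hom_mult[OF w, of a d] hom_mult[OF w, of c b] that ab by simp
    then show ?thesis by simp
  qed
  note unique = this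
  show ?thesis unfolding frac_extend_def
  proof (rule the_equality)
    show "\<exists>c\<in>carrier (mult_of R). \<exists>d\<in>carrier (mult_of R).
        fraction R a b = fraction R c d \<and> w a - w b = w c - w d"
      by (intro bexI[OF _ ab(1)] bexI[OF _ ab(2)]) simp
  qed (metis unique)
qed

lemma frac_extend_hom:
  assumes w: "w \<in> hom (mult_of R) integer_group"
  shows "frac_extend R w \<in> hom (units_of (frac_field R)) integer_group"
proof (rule homI)
  fix x y assume "x \<in> carrier (units_of (frac_field R))" "y \<in> carrier (units_of (frac_field R))"
  then obtain a b c d where
    x: "x = fraction R a b" "a \<in> carrier (mult_of R)" "b \<in> carrier (mult_of R)" and
    y: "y = fraction R c d" "c \<in> carrier (mult_of R)" "d \<in> carrier (mult_of R)"
    by (auto simp: units_of_carrier Units_frac_field)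
  then have "x \<otimes>\<^bsub>frac_field R\<^esub> y = fraction R (a \<otimes> c) (b \<otimes> d)"
    by (simp add: frac_mult)
  moreover have "a \<otimes> c \<in> carrier (mult_of R)" "b \<otimes> d \<in> carrier (mult_of R)"
    using x y by (auto simp: integral_iff)
  ultimately show "frac_extend R w (x \<otimes>\<^bsub>units_of (frac_field R)\<^esub> y) =
      frac_extend R w x \<otimes>\<^bsub>integer_group\<^esub> frac_extend R w y"
    using x y hom_mult[OF w, of a c] hom_mult[OF w, of b d]
    by (simp add: units_of_mult frac_extend_fraction[OF w] del: carrier_mult_of)
qed simp

end

section \<open>Conjugation and norm on the complexification\<close>

context cring
begin

abbreviation cplx where "cplx \<equiv> complexification R"

text \<open>The norm from the complexification down to the base ring, with values in
  \<open>R\<close> itself; embedded by \<open>of_base\<close> it is \<open>f\<close> times its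
  conjugate.\<close>

definition cplx_norm :: "'a \<times> 'a \<Rightarrow> 'a" where
  "cplx_norm f = fst f \<otimes> fst f \<oplus> snd f \<otimes> snd f"

lemma conjugate_eq_conj_pow: "conjugate R = conj_pow R 1"
  by (simp add: conj_pow_def fun_eq_iff)

lemma conjugate_hom: "conjugate R \<in> ring_hom cplx cplx"
  unfolding conjugate_eq_conj_pow by (rule conj_pow_hom)

lemma conjugate_closed: "f \<in> carrier cplx \<Longrightarrow> conjugate R f \<in> carrier cplx"
  by (rule ring_hom_closed[OF conjugate_hom])

lemma conjugate_mult:
  "f \<in> carrier cplx \<Longrightarrow> g \<in> carrier cplx \<Longrightarrow>
    conjugate R (f \<otimes>\<^bsub>cplx\<^esub> g) = conjugate R f \<otimes>\<^bsub>cplx\<^esub> conjugate R g"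
  by (rule ring_hom_mult[OF conjugate_hom])

lemma conjugate_conjugate: "f \<in> carrier cplx \<Longrightarrow> conjugate R (conjugate R f) = f"
  by (auto simp: conjugate_def)

lemma conjugate_Units: "u \<in> Units cplx \<Longrightarrow> conjugate R u \<in> Units cplx"
  unfolding conjugate_eq_conj_pow by (rule conj_pow_Units)

lemma conjugate_of_base: "conjugate R (of_base R a) = of_base R a"
  by (simp add: conjugate_def of_base_def)

lemma conjugate_zero: "conjugate R \<zero>\<^bsub>cplx\<^esub> = \<zero>\<^bsub>cplx\<^esub>"
  by (simp add: conjugate_def)

lemma of_base_closed: "a \<in> carrier R \<Longrightarrow> of_base R a \<in> carrier cplx"
  by (simp add: of_base_def)

lemma of_base_mult:
  "a \<in> carrier R \<Longrightarrow> b \<in> carrier R \<Longrightarrow>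
    of_base R (a \<otimes> b) = of_base R a \<otimes>\<^bsub>cplx\<^esub> of_base R b"
  by (simp add: of_base_def minus_eq)

lemma of_base_one: "of_base R \<one> = \<one>\<^bsub>cplx\<^esub>"
  by (simp add: of_base_def)

lemma of_base_eq_zero: "of_base R a = \<zero>\<^bsub>cplx\<^esub> \<longleftrightarrow> a = \<zero>"
  by (simp add: of_base_def)

lemma of_base_mult_pair:
  "a \<in> carrier R \<Longrightarrow> b \<in> carrier R \<Longrightarrow> c \<in> carrier R \<Longrightarrow>
    of_base R a \<otimes>\<^bsub>cplx\<^esub> (b, c) = (a \<otimes> b, a \<otimes> c)"
  by (simp add: of_base_def minus_eq)

text \<open>Multiplication by a real element acts on each coordinate, so the first coordinate of the
  inverse in \<open>cplx\<close> is an inverse in \<open>R\<close>.\<close>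

lemma Units_of_base:
  assumes "a \<in> carrier R" "of_base R a \<in> Units cplx"
  shows "a \<in> Units R"
proof -
  obtain b c where bc: "b \<in> carrier R" "c \<in> carrier R" "of_base R a \<otimes>\<^bsub>cplx\<^esub> (b, c) = \<one>\<^bsub>cplx\<^esub>"
    using assms(2) unfolding Units_def by auto
  then have "a \<otimes> b = \<one>" using assms(1) by (simp add: of_base_mult_pair)
  then show ?thesis using divides_one[OF assms(1)] bc(1) unfolding factor_def by metis
qed

lemma cplx_norm_closed: "f \<in> carrier cplx \<Longrightarrow> cplx_norm f \<in> carrier R"
  by (auto simp: cplx_norm_def)

lemma mult_conjugate:
  assumes "f \<in> carrier cplx"
  shows "f \<otimes>\<^bsub>cplx\<^esub> conjugate R f = of_base R (cplx_norm f)"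
proof -
  obtain x y where f: "f = (x, y)" "x \<in> carrier R" "y \<in> carrier R" using assms by auto
  then show ?thesis
    by (simp add: cplx_norm_def conjugate_def of_base_def minus_eq r_minus m_comm[of y x] l_neg)
qed

text \<open>Instead of expanding sums of squares, the norm is read in \<open>cplx\<close> as a
  product with the conjugate, the four factors are regrouped, and injectivity of
  \<open>of_base\<close> brings the identity back.\<close>

lemma cplx_norm_mult:
  assumes "f \<in> carrier cplx" "g \<in> carrier cplx"
  shows "cplx_norm (f \<otimes>\<^bsub>cplx\<^esub> g) = cplx_norm f \<otimes> cplx_norm g"
proof -
  interpret B: cring cplx by (rule complexification_cring)
  note [simp del] = complexification_simps
  have "of_base R (cplx_norm (f \<otimes>\<^bsub>cplx\<^esub> g)) =
      (f \<otimes>\<^bsub>cplx\<^esub> g) \<otimes>\<^bsub>cplx\<^esub> conjugate R (f \<otimes>\<^bsub>cplx\<^esub> g)"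
    by (rule mult_conjugate[symmetric, OF B.m_closed[OF assms]])
  also have "\<dots> = (f \<otimes>\<^bsub>cplx\<^esub> conjugate R f) \<otimes>\<^bsub>cplx\<^esub> (g \<otimes>\<^bsub>cplx\<^esub> conjugate R g)"
    unfolding conjugate_mult[OF assms]
    using assms conjugate_closed[OF assms(1)] conjugate_closed[OF assms(2)]
    by (simp add: B.m_ac)
  also have "\<dots> = of_base R (cplx_norm f \<otimes> cplx_norm g)"
    using assms by (simp only: mult_conjugate of_base_mult cplx_norm_closed)
  finally show ?thesis by (simp add: of_base_def)
qed

end

section \<open>The polar group of a factorial domain with factorial complexification\<close>

lemma (in factorial_monoid) exists_prime_divisor:
  assumes "a \<in> carrier G" "a \<notin> Units G"
  shows "\<exists>p \<in> carrier G. prime G p \<and> p divides a"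
proof -
  \<comment> \<open>The alternative of being a unit lets the induction pass through products: if
    neither factor has an irreducible divisor, both are units and so is the product.\<close>
  have "a \<in> Units G \<or> (\<exists>p \<in> carrier G. irreducible G p \<and> p divides a)"
    using assms(1)
  proof (induction rule: factorial_induct)
    case (mult x y)
    then show ?case using divides_prod_r divides_prod_l by (metis Units_m_closed)
  qed auto
  with assms show ?thesis using irreducible_prime by blast
qed

text \<open>Invertibility of 2 allows an element \<open>x\<close> to be recovered from
  \<open>x \<oplus> x\<close>, that is, the components of \<open>f\<close> from the sum and
  difference of \<open>f\<close> and its conjugate.\<close>

locale polar_factorial = A: factorial_domain A + B: factorial_domain "complexification A"
  for A :: "('a, 'm) ring_scheme" (structure) +
  assumes two_unit: "\<one> \<oplus> \<one> \<in> Units A"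
begin

declare complexification_simps [simp del]

abbreviation B where "B \<equiv> complexification A"
abbreviation bar where "bar \<equiv> conjugate A"
abbreviation L where "L \<equiv> units_of (frac_field B)"
abbreviation H where "H \<equiv> polar_subgroup A"

section \<open>Conjugation as a symmetry of irreducibles and valuations\<close>

lemma conjugate_mult_of: "f \<in> carrier (mult_of B) \<Longrightarrow> bar f \<in> carrier (mult_of B)"
  using A.conjugate_closed[of f] A.conjugate_conjugate[of f] A.conjugate_zero by auto

lemma of_base_mult_of: "a \<in> carrier (mult_of A) \<Longrightarrow> of_base A a \<in> carrier (mult_of B)"
  by (simp add: A.of_base_closed A.of_base_eq_zero)

text \<open>Conjugation is an involutive ring automorphism, so it carries a factorization of
  \<open>bar q\<close> to one of \<open>q\<close> and units to units.\<close>

lemma conjugate_irreducible: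
  assumes q: "q \<in> carrier (mult_of B)" and irr: "irreducible (mult_of B) q"
  shows "irreducible (mult_of B) (bar q)"
proof -
  have q': "q \<in> carrier B" using q by simp
  have irr': "ring_irreducible\<^bsub>B\<^esub> q" using q irr by (intro B.ring_irreducibleI') auto
  have "ring_irreducible\<^bsub>B\<^esub> (bar q)"
  proof (rule B.ring_irreducibleI)
    show "bar q \<in> carrier B - {\<zero>\<^bsub>B\<^esub>}" using conjugate_mult_of[OF q] by simp
    show "bar q \<notin> Units B"
      using A.conjugate_Units[of "bar q"] B.ring_irreducibleE(4)[OF q' irr'] 
      by (auto simp: A.conjugate_conjugate[OF q'])
    fix f g assume fg: "f \<in> carrier B" "g \<in> carrier B" "bar q = f \<otimes>\<^bsub>B\<^esub> g"
    then have "q = bar f \<otimes>\<^bsub>B\<^esub> bar g"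
      by (metis A.conjugate_conjugate A.conjugate_mult q')
    then have "bar f \<in> Units B \<or> bar g \<in> Units B"
      using B.ring_irreducibleE(5)[OF q' irr'] fg A.conjugate_closed by blast
    then show "f \<in> Units B \<or> g \<in> Units B"
      using fg A.conjugate_Units A.conjugate_conjugate by metis
  qed
  then show ?thesis
    using B.ring_irreducibleE(3)[OF A.conjugate_closed[OF q']] by simp
qed

lemma conjugate_associated:
  assumes "f \<in> carrier (mult_of B)" "g \<in> carrier (mult_of B)" "f \<sim>\<^bsub>mult_of B\<^esub> g"
  shows "bar f \<sim>\<^bsub>mult_of B\<^esub> bar g"
proof -
  obtain u where u: "f = g \<otimes>\<^bsub>B\<^esub> u" "u \<in> Units B"
    using B.mult_of.associatedE2[OF assms(3) _ assms(1,2)] by auto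
  then have "bar f = bar g \<otimes>\<^bsub>B\<^esub> bar u" using assms by (simp add: A.conjugate_mult B.Units_closed)
  then show ?thesis
    using A.conjugate_Units[OF u(2)] assms conjugate_mult_of
    by (intro B.mult_of.associatedI2'[of _ _ "bar u"]) auto
qed

abbreviation val where "val \<equiv> prime_valuation (mult_of B)"

text \<open>Both sides are additive in \<open>f\<close> and vanish on units, which leaves
  irreducible \<open>f\<close>; there each side only tests association.\<close>

lemma val_conjugate:
  assumes p: "p \<in> carrier (mult_of B)" and f: "f \<in> carrier (mult_of B)"
  shows "val (bar p) (bar f) = val p f"
  using f
proof (induction rule: B.factorial_induct)
  case (unit u)
  then show ?case
    using A.conjugate_Units[of u] by (simp add: B.prime_valuation_Units)
next
  case (irreducible q)
  \<comment> \<open>The forward direction comes from conjugating once more, since \<open>bar\<close>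
    is an involution.\<close>
  have "bar q \<sim>\<^bsub>mult_of B\<^esub> bar p \<longleftrightarrow> q \<sim>\<^bsub>mult_of B\<^esub> p"
    using conjugate_associated[of q p] conjugate_associated[of "bar q" "bar p"] p irreducible(1)
      conjugate_mult_of[of p] conjugate_mult_of[of q] A.conjugate_conjugate by auto
  then show ?case
    using p irreducible conjugate_mult_of conjugate_irreducible
    by (simp add: B.prime_valuation_irreducible del: carrier_mult_of)
next
  case (mult x y)
  have "bar (x \<otimes>\<^bsub>B\<^esub> y) = bar x \<otimes>\<^bsub>B\<^esub> bar y"
    using mult by (intro A.conjugate_mult) auto
  then show ?case
    using mult conjugate_mult_of
    by (simp add: B.prime_valuation_mult[unfolded mult_mult_of] del: carrier_mult_of)
qed

section \<open>Irreducibles without real divisor and their conjugates\<close>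

text \<open>Primality removes the square and invertibility of 2 removes the doubling. The square has
  this form because it is the norm of an element whose only nonzero component is
  \<open>x \<oplus> x\<close>.\<close>

lemma prime_divides_component:
  assumes p: "p \<in> carrier A" "prime A p" and x: "x \<in> carrier A"
    and dvd: "p divides (x \<oplus> x) \<otimes> (x \<oplus> x)"
  shows "p divides x"
proof -
  have "p divides (x \<oplus> x)" using p(2) dvd x by (auto elim!: primeE)
  then obtain c where c: "c \<in> carrier A" "x \<oplus> x = p \<otimes> c" by (auto elim: dividesE)
  have "x = inv (\<one> \<oplus> \<one>) \<otimes> ((\<one> \<oplus> \<one>) \<otimes> x)"
    using two_unit x by (simp add: A.m_assoc[symmetric])
  also have "(\<one> \<oplus> \<one>) \<otimes> x = p \<otimes> c" using x c by (simp add: A.l_distr)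
  finally have "x = p \<otimes> (inv (\<one> \<oplus> \<one>) \<otimes> c)"
    using p(1) c two_unit by (simp add: A.m_lcomm)
  then show ?thesis using c two_unit by (intro dividesI) auto
qed

lemma Delta1_mult_of:
  assumes "t \<in> Delta1 A"
  shows "t \<in> carrier (mult_of B)" "irreducible (mult_of B) t"
  using assms B.ring_irreducibleE(3)[of t] by (auto simp: Delta1_def Delta_def)

text \<open>
  Were \<open>t\<close> associated to its conjugate, it would divide both \<open>t + bar t\<close> and \<open>t - bar t\<close>. Taking
  norms, each prime of \<open>A\<close> dividing the norm of \<open>t\<close> would divide both components of \<open>t\<close>.
\<close>

lemma Delta1_not_associated_conjugate:
  assumes t: "t \<in> Delta1 A"
  shows "\<not> bar t \<sim>\<^bsub>mult_of B\<^esub> t"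
proof
  assume "bar t \<sim>\<^bsub>mult_of B\<^esub> t"
  note tB = Delta1_mult_of[OF t]
  from tB(1) have tc: "t \<in> carrier B" by simp
  obtain u where u: "bar t = t \<otimes>\<^bsub>B\<^esub> u" "u \<in> Units B"
    using B.mult_of.associatedE2[OF \<open>bar t \<sim>\<^bsub>mult_of B\<^esub> t\<close> _ conjugate_mult_of[OF tB(1)] tB(1)]
    by auto
  obtain x y where xy: "t = (x, y)" "x \<in> carrier A" "y \<in> carrier A"
    using tc by (auto simp: complexification_simps)
  let ?n = "A.cplx_norm t"
  have n: "?n \<in> carrier A" using A.cplx_norm_closed[OF tc] .
  have n0: "?n \<noteq> \<zero>"
    using A.mult_conjugate[OF tc] tB(1) conjugate_mult_of[OF tB(1)] A.of_base_eq_zero[of ?n]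
      B.integral[of t "bar t"] by auto
  have tU: "t \<notin> Units B" using tB by (auto simp: irreducible_def)
  \<comment> \<open>A unit norm with inverse \<open>m\<close> would make \<open>bar t\<close> times
    \<open>m\<close> an inverse of \<open>t\<close>, although \<open>t\<close> is
    irreducible.\<close>
  have nU: "?n \<notin> Units A"
  proof
    assume "?n \<in> Units A"
    then have "?n divides \<one>" using A.divides_one[OF n] by blast
    then obtain m where m: "m \<in> carrier A" "?n \<otimes> m = \<one>" by (auto elim!: dividesE)
    then have "t \<otimes>\<^bsub>B\<^esub> (bar t \<otimes>\<^bsub>B\<^esub> of_base A m) = \<one>\<^bsub>B\<^esub>"
      using n A.mult_conjugate[OF tc] A.of_base_mult[OF n m(1)] A.of_base_one
        A.conjugate_closed[OF tc] A.of_base_closed[OF m(1)] tc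
      by (simp add: B.m_assoc[symmetric])
    moreover have "bar t \<otimes>\<^bsub>B\<^esub> of_base A m \<in> carrier B"
      using A.conjugate_closed[OF tc] A.of_base_closed[OF m(1)] by simp
    ultimately have "t divides\<^bsub>B\<^esub> \<one>\<^bsub>B\<^esub>" by (intro dividesI) auto
    then show False using B.divides_one[OF tc] tU by simp
  qed
  have "?n \<in> carrier (mult_of A)" "?n \<notin> Units (mult_of A)"
    using n n0 nU by simp_all
  then obtain p where p: "p \<in> carrier (mult_of A)" "prime (mult_of A) p"
      "p divides\<^bsub>mult_of A\<^esub> ?n"
    using A.exists_prime_divisor by blast
  have pA: "p \<in> carrier A" "prime A p" "p divides ?n"
    using p A.prime_eq_prime_mult[of p] by simp_all
  have norm_dvd: "p divides A.cplx_norm (t \<otimes>\<^bsub>B\<^esub> g)" if "g \<in> carrier B" for g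
    using A.cplx_norm_mult[OF tc that] A.divides_prod_r[OF pA(3)] pA n A.cplx_norm_closed[OF that]
    by simp
  \<comment> \<open>Since \<open>bar t\<close> is \<open>t\<close> times \<open>u\<close>, the sum
    and difference of \<open>t\<close> and \<open>bar t\<close> are multiples of \<open>t\<close>,
    so \<open>norm_dvd\<close> applies to them; each has a single nonzero component at most.\<close>
  have sum: "t \<otimes>\<^bsub>B\<^esub> (\<one>\<^bsub>B\<^esub> \<oplus>\<^bsub>B\<^esub> u) = (x \<oplus> x, \<zero>)"
  proof -
    have "t \<otimes>\<^bsub>B\<^esub> (\<one>\<^bsub>B\<^esub> \<oplus>\<^bsub>B\<^esub> u) = t \<oplus>\<^bsub>B\<^esub> bar t"
      unfolding u(1) using tc B.Units_closed[OF u(2)] by (simp add: B.r_distr)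
    also have "\<dots> = (x \<oplus> x, \<zero>)"
      using xy by (simp add: conjugate_def complexification_simps A.r_neg)
    finally show ?thesis .
  qed
  have diff: "t \<otimes>\<^bsub>B\<^esub> (\<one>\<^bsub>B\<^esub> \<ominus>\<^bsub>B\<^esub> u) = (\<zero>, y \<oplus> y)"
  proof -
    have "t \<otimes>\<^bsub>B\<^esub> (\<one>\<^bsub>B\<^esub> \<ominus>\<^bsub>B\<^esub> u) = t \<ominus>\<^bsub>B\<^esub> bar t"
      unfolding u(1) using tc B.Units_closed[OF u(2)] by (simp add: B.minus_eq B.r_distr B.r_minus)
    also have "\<dots> = (\<zero>, y \<oplus> y)"
    proof -
      \<comment> \<open>Subtraction in \<open>B\<close> is not given in coordinates, so the
        difference is recognised by adding \<open>bar t\<close> back.\<close>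
      have "(\<zero>, y \<oplus> y) \<oplus>\<^bsub>B\<^esub> bar t = t"
        using xy by (simp add: conjugate_def complexification_simps A.a_assoc A.r_neg)
      moreover have "(\<zero>, y \<oplus> y) \<in> carrier B" using xy by (simp add: complexification_simps)
      ultimately show ?thesis
        using A.conjugate_closed[OF tc] by (metis B.add.inv_solve_right' B.minus_eq tc)
    qed
    finally show ?thesis .
  qed
  have "p divides x" "p divides y"
    using norm_dvd[of "\<one>\<^bsub>B\<^esub> \<oplus>\<^bsub>B\<^esub> u"] norm_dvd[of "\<one>\<^bsub>B\<^esub> \<ominus>\<^bsub>B\<^esub> u"] B.Units_closed[OF u(2)] xy
    unfolding sum diff
    by (auto intro!: prime_divides_component[OF pA(1,2)] simp: A.cplx_norm_def)
  then obtain x' y' where xy': "x = p \<otimes> x'" "x' \<in> carrier A" "y = p \<otimes> y'" "y' \<in> carrier A"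
    by (auto elim!: dividesE)
  \<comment> \<open>The prime \<open>p\<close> is thus a real divisor of \<open>t\<close>, which
    would force it to be a unit.\<close>
  then have "t = of_base A p \<otimes>\<^bsub>B\<^esub> (x', y')"
    using xy pA by (simp add: A.of_base_mult_pair)
  then have "t = (x', y') \<otimes>\<^bsub>B\<^esub> of_base A p"
    using xy' A.of_base_closed[OF pA(1)] B.m_comm[of "of_base A p" "(x', y')"]
    by (simp add: complexification_simps(1))
  then have "t \<in> PIdl\<^bsub>B\<^esub> (of_base A p)"
    using xy' by (auto simp: cgenideal_def complexification_simps(1))
  then have "p \<in> Units A"
    using t p(1) by (auto simp: Delta1_def Delta_def no_real_divisor_def)
  then show False using pA(2) by (auto elim: primeE)
qed

section \<open>The polar group as a quotient of the units of the fraction field\<close>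

abbreviation P where "P \<equiv> polar_group A"

lemma comm_group_L: "comm_group L"
proof -
  interpret F: field "frac_field B" by (rule B.frac_field_is_field)
  show ?thesis by (rule F.units_comm_group)
qed

lemma carrier_L: "carrier L = {fraction B f g | f g. f \<in> carrier (mult_of B) \<and> g \<in> carrier (mult_of B)}"
  by (simp add: units_of_carrier B.Units_frac_field)

text \<open>A nonzero element of \<open>K\<close> is a quotient of nonzero elements of
  \<open>A\<close>, and the unit can be absorbed into the numerator. This normal form is what
  membership in \<open>H\<close> is checked against below.\<close>

lemma polar_subgroup_eq:
  "H = {fraction B (u \<otimes>\<^bsub>B\<^esub> of_base A a) (of_base A b) | u a b.
     u \<in> Units B \<and> a \<in> carrier (mult_of A) \<and> b \<in> carrier (mult_of A)}"
proof -
  have "frac_incl B u \<otimes>\<^bsub>frac_field B\<^esub> frac_map B (of_base A) (fraction A a b) =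
      fraction B (u \<otimes>\<^bsub>B\<^esub> of_base A a) (of_base A b)"
    if "u \<in> Units B" "a \<in> carrier (mult_of A)" "b \<in> carrier (mult_of A)" for u a b
  proof -
    have "a \<in> carrier A" "b \<in> carrier A - {\<zero>}" using that by auto
    then show ?thesis
      using that of_base_mult_of[OF that(2)] of_base_mult_of[OF that(3)]
      by (simp add: frac_incl_def frac_map_fraction[OF A.domain_axioms B.domain_axioms]
          B.frac_mult B.Units_closed)
  qed
  note * = this
  show ?thesis
  proof (intro equalityI subsetI)
    fix x assume "x \<in> H"
    then obtain u k where u: "u \<in> Units B" "k \<in> Units (frac_field A)"
      "x = frac_incl B u \<otimes>\<^bsub>frac_field B\<^esub> frac_map B (of_base A) k"
      unfolding polar_subgroup_def Let_def set_mult_def units_of_mult by blast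
    then obtain a b where ab: "a \<in> carrier (mult_of A)" "b \<in> carrier (mult_of A)" "k = fraction A a b"
      unfolding A.Units_frac_field carrier_mult_of by blast
    show "x \<in> {fraction B (u \<otimes>\<^bsub>B\<^esub> of_base A a) (of_base A b) | u a b.
        u \<in> Units B \<and> a \<in> carrier (mult_of A) \<and> b \<in> carrier (mult_of A)}"
      using *[OF u(1) ab(1,2)] u ab by blast
  next
    fix x assume "x \<in> {fraction B (u \<otimes>\<^bsub>B\<^esub> of_base A a) (of_base A b) | u a b.
        u \<in> Units B \<and> a \<in> carrier (mult_of A) \<and> b \<in> carrier (mult_of A)}"
    then obtain u a b where u: "u \<in> Units B" "a \<in> carrier (mult_of A)" "b \<in> carrier (mult_of A)"
      "x = fraction B (u \<otimes>\<^bsub>B\<^esub> of_base A a) (of_base A b)" by blast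
    have "fraction A a b \<in> Units (frac_field A)" using u by (auto simp: A.Units_frac_field)
    then show "x \<in> H"
      unfolding polar_subgroup_def Let_def set_mult_def units_of_mult u(4) *[OF u(1-3), symmetric]
      using u(1) by blast
  qed
qed

lemma subgroup_H: "subgroup H L"
proof -
  interpret L: comm_group L by (rule comm_group_L)
  have Uc: "u \<in> carrier (mult_of B)" if "u \<in> Units B" for u
    using that B.mult_of.Units_closed by simp
  show ?thesis
  proof (rule L.subgroupI)
    show "H \<subseteq> carrier L"
      unfolding polar_subgroup_eq carrier_L
      using Uc of_base_mult_of B.mult_of.m_closed by blast
    show "H \<noteq> {}"
      unfolding polar_subgroup_eq using B.Units_one_closed A.mult_of.one_closed by blast
  next
    fix x y assume "x \<in> H" "y \<in> H"
    then obtain u a b v c d where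
      x: "x = fraction B (u \<otimes>\<^bsub>B\<^esub> of_base A a) (of_base A b)"
        "u \<in> Units B" "a \<in> carrier (mult_of A)" "b \<in> carrier (mult_of A)" and
      y: "y = fraction B (v \<otimes>\<^bsub>B\<^esub> of_base A c) (of_base A d)"
        "v \<in> Units B" "c \<in> carrier (mult_of A)" "d \<in> carrier (mult_of A)"
      unfolding polar_subgroup_eq by blast
    have ob: "of_base A a \<in> carrier (mult_of B)" "of_base A b \<in> carrier (mult_of B)"
      "of_base A c \<in> carrier (mult_of B)" "of_base A d \<in> carrier (mult_of B)"
      using x y of_base_mult_of by blast+
    have "x \<otimes>\<^bsub>L\<^esub> y = fraction B ((u \<otimes>\<^bsub>B\<^esub> of_base A a) \<otimes>\<^bsub>B\<^esub> (v \<otimes>\<^bsub>B\<^esub> of_base A c))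
        (of_base A b \<otimes>\<^bsub>B\<^esub> of_base A d)"
      using x y ob by (simp add: units_of_mult B.frac_mult B.Units_closed)
    also have "(u \<otimes>\<^bsub>B\<^esub> of_base A a) \<otimes>\<^bsub>B\<^esub> (v \<otimes>\<^bsub>B\<^esub> of_base A c) =
        (u \<otimes>\<^bsub>B\<^esub> v) \<otimes>\<^bsub>B\<^esub> of_base A (a \<otimes> c)"
      using x y ob by (simp add: A.of_base_mult B.Units_closed B.m_ac)
    also have "of_base A b \<otimes>\<^bsub>B\<^esub> of_base A d = of_base A (b \<otimes> d)"
      using x y by (simp add: A.of_base_mult)
    finally have "x \<otimes>\<^bsub>L\<^esub> y = fraction B ((u \<otimes>\<^bsub>B\<^esub> v) \<otimes>\<^bsub>B\<^esub> of_base A (a \<otimes> c)) (of_base A (b \<otimes> d))" .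
    then show "x \<otimes>\<^bsub>L\<^esub> y \<in> H"
      unfolding polar_subgroup_eq
      using B.Units_m_closed[OF x(2) y(2)] A.mult_of.m_closed[OF x(3) y(3)]
        A.mult_of.m_closed[OF x(4) y(4)] by blast
  next
    fix x assume "x \<in> H"
    then obtain u a b where
      x: "x = fraction B (u \<otimes>\<^bsub>B\<^esub> of_base A a) (of_base A b)"
        "u \<in> Units B" "a \<in> carrier (mult_of A)" "b \<in> carrier (mult_of A)"
      unfolding polar_subgroup_eq by blast
    define v where "v = inv\<^bsub>B\<^esub> u"
    have v: "v \<in> Units B" "v \<otimes>\<^bsub>B\<^esub> u = \<one>\<^bsub>B\<^esub>" using x(2) by (auto simp: v_def)
    have ob: "of_base A a \<in> carrier (mult_of B)" "of_base A b \<in> carrier (mult_of B)"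
      using x of_base_mult_of by blast+
    \<comment> \<open>The inverse of ua/b is again in normal form: invert the unit and exchange the
      two real elements.\<close>
    define y where "y = fraction B (v \<otimes>\<^bsub>B\<^esub> of_base A b) (of_base A a)"
    have yL: "y \<in> carrier L" and xL: "x \<in> carrier L"
      unfolding carrier_L x(1) y_def
      using Uc[OF v(1)] Uc[OF x(2)] ob B.mult_of.m_closed by blast+
    have "y \<otimes>\<^bsub>L\<^esub> x = fraction B ((v \<otimes>\<^bsub>B\<^esub> of_base A b) \<otimes>\<^bsub>B\<^esub> (u \<otimes>\<^bsub>B\<^esub> of_base A a))
        (of_base A a \<otimes>\<^bsub>B\<^esub> of_base A b)"
      using x v ob by (simp add: y_def units_of_mult B.frac_mult B.Units_closed)
    also have "(v \<otimes>\<^bsub>B\<^esub> of_base A b) \<otimes>\<^bsub>B\<^esub> (u \<otimes>\<^bsub>B\<^esub> of_base A a) =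
        (v \<otimes>\<^bsub>B\<^esub> u) \<otimes>\<^bsub>B\<^esub> (of_base A a \<otimes>\<^bsub>B\<^esub> of_base A b)"
      using x v(1) ob by (simp add: B.Units_closed B.m_ac)
    also have "fraction B \<dots> (of_base A a \<otimes>\<^bsub>B\<^esub> of_base A b) = \<one>\<^bsub>L\<^esub>"
      using ob by (simp add: v(2) units_of_one B.frac_field_one B.frac_eq_iff B.integral_iff)
    finally have "inv\<^bsub>L\<^esub> x = y" using xL yL by (rule L.inv_equality)
    then show "inv\<^bsub>L\<^esub> x \<in> H"
      unfolding polar_subgroup_eq y_def using v(1) x by blast
  qed
qed

lemma normal_H: "H \<lhd> L"
  using comm_group.normal_iff_subgroup[OF comm_group_L] subgroup_H by blast

lemma comm_group_polar_group: "comm_group P"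
  unfolding polar_group_def by (rule comm_group.abelian_FactGroup[OF comm_group_L subgroup_H])

section \<open>The class map on nonzero elements and homomorphisms to the integers\<close>

lemma frac_incl_hom: "frac_incl B \<in> hom (mult_of B) L"
proof (rule homI)
  show "frac_incl B f \<in> carrier L" if "f \<in> carrier (mult_of B)" for f
    unfolding carrier_L frac_incl_def using that B.mult_of.one_closed by blast
qed (simp add: frac_incl_def units_of_mult B.frac_mult)

lemma polar_class_hom: "polar_class A \<in> hom (mult_of B) P"
proof -
  have "polar_class A = (\<lambda>x. H #>\<^bsub>L\<^esub> x) \<circ> frac_incl B"
    by (rule ext) (simp add: polar_class_def Let_def)
  then show ?thesis
    using hom_compose[OF frac_incl_hom normal.r_coset_hom_Mod[OF normal_H]]
    by (simp add: polar_group_def)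
qed

lemma polar_class_eq_one:
  assumes "u \<in> Units B" "a \<in> carrier (mult_of A)"
  shows "polar_class A (u \<otimes>\<^bsub>B\<^esub> of_base A a) = \<one>\<^bsub>P\<^esub>"
proof -
  interpret L: comm_group L by (rule comm_group_L)
  \<comment> \<open>The denominator 1 is itself real, so this fraction is in the normal form for
    \<open>H\<close>.\<close>
  have "frac_incl B (u \<otimes>\<^bsub>B\<^esub> of_base A a) = fraction B (u \<otimes>\<^bsub>B\<^esub> of_base A a) (of_base A \<one>)"
    by (simp add: frac_incl_def A.of_base_one)
  then have mem: "frac_incl B (u \<otimes>\<^bsub>B\<^esub> of_base A a) \<in> H"
    unfolding polar_subgroup_eq using assms A.mult_of.one_closed by blast
  show ?thesis
    unfolding polar_class_def Let_def polar_group_def one_FactGroup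
    by (rule L.coset_join2[OF subgroup.mem_carrier[OF subgroup_H mem] subgroup_H mem])
qed

lemma polar_class_Units: "u \<in> Units B \<Longrightarrow> polar_class A u = \<one>\<^bsub>P\<^esub>"
  using polar_class_eq_one[of u \<one>] by (simp add: A.of_base_one B.Units_closed)

lemma polar_class_mult_unit:
  assumes "u \<in> Units B" "f \<in> carrier (mult_of B)"
  shows "polar_class A (u \<otimes>\<^bsub>B\<^esub> f) = polar_class A f"
proof -
  interpret P: comm_group P by (rule comm_group_polar_group)
  have "u \<in> carrier (mult_of B)" using assms(1) B.mult_of.Units_closed by simp
  then show ?thesis
    using hom_mult[OF polar_class_hom, of u f] assms hom_in_carrier[OF polar_class_hom]
    by (simp add: polar_class_Units del: carrier_mult_of)
qed

lemma polar_class_conjugate: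
  assumes "f \<in> carrier (mult_of B)"
  shows "polar_class A (bar f) = inv\<^bsub>P\<^esub> polar_class A f"
proof -
  interpret P: comm_group P by (rule comm_group_polar_group)
  have f: "f \<in> carrier B" using assms by simp
  \<comment> \<open>In a domain this product is nonzero, hence so is the norm, as
    \<open>polar_class_eq_one\<close> requires.\<close>
  have "f \<otimes>\<^bsub>B\<^esub> bar f \<in> carrier (mult_of B)"
    using B.mult_of.m_closed assms conjugate_mult_of by blast
  then have n: "A.cplx_norm f \<in> carrier (mult_of A)"
    using A.cplx_norm_closed[OF f] by (simp add: A.mult_conjugate[OF f] A.of_base_eq_zero)
  have "polar_class A (bar f) \<otimes>\<^bsub>P\<^esub> polar_class A f = polar_class A (bar f \<otimes>\<^bsub>B\<^esub> f)"
    using hom_mult[OF polar_class_hom] assms conjugate_mult_of by simp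
  also have "bar f \<otimes>\<^bsub>B\<^esub> f = \<one>\<^bsub>B\<^esub> \<otimes>\<^bsub>B\<^esub> of_base A (A.cplx_norm f)"
    using f A.conjugate_closed[OF f] A.mult_conjugate[OF f] B.m_comm[of f "bar f"]
      A.of_base_closed[OF A.cplx_norm_closed[OF f]] by simp
  also have "polar_class A \<dots> = \<one>\<^bsub>P\<^esub>" using n by (intro polar_class_eq_one) auto
  finally show ?thesis
    using hom_in_carrier[OF polar_class_hom] assms conjugate_mult_of P.inv_equality by metis
qed

text \<open>A representative f/g times \<open>g\<close> is \<open>f\<close>, and passing to cosets
  is multiplicative. Generation of the polar group is thereby reduced to classes of elements of
  \<open>B\<close>.\<close>

lemma carrier_polar_groupE:
  assumes "x \<in> carrier P"
  obtains f g where "f \<in> carrier (mult_of B)" "g \<in> carrier (mult_of B)"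
    "x = polar_class A f \<otimes>\<^bsub>P\<^esub> inv\<^bsub>P\<^esub> polar_class A g"
proof -
  interpret P: comm_group P by (rule comm_group_polar_group)
  let ?\<pi> = "\<lambda>y. H #>\<^bsub>L\<^esub> y"
  have \<pi>: "?\<pi> \<in> hom L P"
    using normal.r_coset_hom_Mod[OF normal_H] by (simp add: polar_group_def)
  obtain y where y: "y \<in> carrier L" "x = ?\<pi> y"
    using assms by (auto simp: polar_group_def carrier_FactGroup)
  then obtain f g where fg: "f \<in> carrier (mult_of B)" "g \<in> carrier (mult_of B)" "y = fraction B f g"
    unfolding carrier_L by blast
  have "y \<otimes>\<^bsub>L\<^esub> frac_incl B g = frac_incl B f"
    using fg by (simp add: frac_incl_def units_of_mult B.frac_mult B.frac_eq_iff B.m_comm)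
  then have "x \<otimes>\<^bsub>P\<^esub> polar_class A g = polar_class A f"
    using hom_mult[OF \<pi> y(1) hom_in_carrier[OF frac_incl_hom fg(2)]] y(2)
    by (simp add: polar_class_def Let_def)
  then have "x = polar_class A f \<otimes>\<^bsub>P\<^esub> inv\<^bsub>P\<^esub> polar_class A g"
    using hom_in_carrier[OF polar_class_hom fg(2)] assms
    by (metis P.inv_closed P.m_assoc P.r_inv P.r_one)
  with fg that show thesis by blast
qed

text \<open>The difference of the two valuations is additive on nonzero elements, extends to
  fractions through \<open>frac_extend\<close>, and factors through the quotient because it vanishes
  on \<open>H\<close>.\<close>

lemma polar_dual_hom:
  assumes t: "t \<in> carrier (mult_of B)"
  obtains w where "w \<in> hom P integer_group"
    "\<And>f. f \<in> carrier (mult_of B) \<Longrightarrow> w (polar_class A f) = int (val t f) - int (val (bar t) f)"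
proof -
  define v where "v f = int (val t f) - int (val (bar t) f)" for f
  have v: "v \<in> hom (mult_of B) integer_group"
    by (rule homI) (simp_all add: v_def B.prime_valuation_mult[unfolded mult_mult_of])
  have v_one: "v \<one>\<^bsub>B\<^esub> = 0"
    using B.prime_valuation_Units[of "\<one>\<^bsub>B\<^esub>"] by (simp add: v_def)
  have v_unit: "v u = 0" if "u \<in> Units B" for u
    using that by (simp add: v_def B.prime_valuation_Units)
  \<comment> \<open>A real element is its own conjugate, so \<open>val_conjugate\<close> gives it
    the same valuation at \<open>t\<close> and at \<open>bar t\<close>.\<close>
  have v_real: "v (of_base A a) = 0" if "a \<in> carrier (mult_of A)" for a
    using val_conjugate[OF t of_base_mult_of[OF that]] by (simp add: v_def A.conjugate_of_base)
  let ?e = "frac_extend B v"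
  have e: "?e \<in> hom L integer_group" by (rule B.frac_extend_hom[OF v])
  interpret e: group_hom L integer_group ?e
    using comm_group.axioms(2)[OF comm_group_L] e by (simp add: group_hom_def group_hom_axioms_def)
  have "H \<subseteq> kernel L integer_group ?e"
  proof
    fix x assume x: "x \<in> H"
    then obtain u a b where uab: "u \<in> Units B" "a \<in> carrier (mult_of A)" "b \<in> carrier (mult_of A)"
      "x = fraction B (u \<otimes>\<^bsub>B\<^esub> of_base A a) (of_base A b)"
      unfolding polar_subgroup_eq by blast
    have u: "u \<in> carrier (mult_of B)" using uab(1) B.mult_of.Units_closed by simp
    have ua: "u \<otimes>\<^bsub>B\<^esub> of_base A a \<in> carrier (mult_of B)"
      using B.mult_of.m_closed[OF u of_base_mult_of[OF uab(2)]] .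
    have "?e x = v (u \<otimes>\<^bsub>B\<^esub> of_base A a) - v (of_base A b)"
      unfolding uab(4) by (rule B.frac_extend_fraction[OF v ua of_base_mult_of[OF uab(3)]])
    also have "\<dots> = 0"
      using hom_mult[OF v u of_base_mult_of[OF uab(2)]] uab by (simp add: v_unit v_real)
    finally show "x \<in> kernel L integer_group ?e"
      using subgroup.mem_carrier[OF subgroup_H x] by (simp add: kernel_def)
  qed
  then obtain w where w: "w \<in> hom (L Mod H) integer_group"
      "\<And>x. x \<in> carrier L \<Longrightarrow> w (H #>\<^bsub>L\<^esub> x) = ?e x"
    using e.FactGroup_universal_kernel[OF normal_H] by blast
  show thesis
  proof
    show "w \<in> hom P integer_group" using w(1) by (simp add: polar_group_def)
    fix f assume f: "f \<in> carrier (mult_of B)"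
    have "w (polar_class A f) = ?e (frac_incl B f)"
      using w(2)[OF hom_in_carrier[OF frac_incl_hom f]] by (simp add: polar_class_def Let_def)
    also have "\<dots> = v f"
      using B.frac_extend_fraction[OF v f B.mult_of.one_closed] by (simp add: frac_incl_def v_one)
    finally show "w (polar_class A f) = int (val t f) - int (val (bar t) f)" by (simp add: v_def)
  qed
qed

section \<open>Orbits of \<open>Gamma\<close> and transversals\<close>

lemma orbit_Gamma:
  assumes f: "f \<in> carrier (mult_of B)"
  shows "orbit (Gamma A) (Gamma_act A) f =
    {u \<otimes>\<^bsub>B\<^esub> g | u g. u \<in> Units B \<and> g \<in> {f, bar f}}"
proof -
  \<comment> \<open>\<open>Gamma_act\<close> is restricted to nonzero elements; \<open>f\<close> is
    one of them, so the formula for the action is available.\<close>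
  have act: "Gamma_act A (u, s) f = u \<otimes>\<^bsub>B\<^esub> conj_pow A s f" for u s
    using f by (simp add: Gamma_act_def)
  have cp: "(\<lambda>s. conj_pow A s f) ` {0, 1} = {f, bar f}" by (simp add: conj_pow_def insert_commute)
  have "orbit (Gamma A) (Gamma_act A) f =
      {Gamma_act A (u, s) f | u s. u \<in> Units B \<and> s \<in> {0, 1}}"
    unfolding orbit_def A.Gamma_simps by blast
  also have "\<dots> = {u \<otimes>\<^bsub>B\<^esub> g | u g. u \<in> Units B \<and> g \<in> {f, bar f}}"
    unfolding act cp[symmetric] by blast
  finally show ?thesis .
qed

context
  fixes T assumes T: "is_transversal A T"
begin

lemma transversal_Delta1: "t \<in> T \<Longrightarrow> t \<in> Delta1 A"
  using T by (auto simp: is_transversal_def)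

lemma transversal_exists:
  assumes q: "q \<in> Delta1 A"
  obtains u t where "u \<in> Units B" "t \<in> T" "t = u \<otimes>\<^bsub>B\<^esub> q \<or> t = u \<otimes>\<^bsub>B\<^esub> bar q"
proof -
  have "orbit (Gamma A) (Gamma_act A) q \<in> orbits (Gamma A) (Delta1 A) (Gamma_act A)"
    using q unfolding orbits_def by blast
  then obtain t where "t \<in> T" "t \<in> orbit (Gamma A) (Gamma_act A) q"
    using T unfolding is_transversal_def by blast
  then show thesis
    using that unfolding orbit_Gamma[OF Delta1_mult_of(1)[OF q]] by blast
qed

text \<open>The orbit of \<open>t\<close> consists of the associates of \<open>t\<close> and of
  \<open>bar t\<close>, so \<open>s\<close> and \<open>t\<close> lie in one orbit, which meets
  \<open>T\<close> only once.\<close>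

lemma transversal_unique:
  assumes s: "s \<in> T" and t: "t \<in> T"
    and assoc: "s \<sim>\<^bsub>mult_of B\<^esub> t \<or> s \<sim>\<^bsub>mult_of B\<^esub> bar t"
  shows "s = t"
proof -
  have sB: "s \<in> carrier (mult_of B)" and tB: "t \<in> carrier (mult_of B)"
    using Delta1_mult_of(1) transversal_Delta1 s t by blast+
  have W: "orbit (Gamma A) (Gamma_act A) t \<in> orbits (Gamma A) (Delta1 A) (Gamma_act A)"
    using transversal_Delta1[OF t] unfolding orbits_def by blast
  obtain u g where "s = g \<otimes>\<^bsub>B\<^esub> u" "u \<in> Units B" and g: "g \<in> {t, bar t}" "g \<in> carrier (mult_of B)"
    using assoc B.mult_of.associatedE2[of s t] B.mult_of.associatedE2[of s "bar t"]
      sB tB conjugate_mult_of[OF tB] B.Units_mult_eq_Units by (metis insertCI)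
  then have "s = u \<otimes>\<^bsub>B\<^esub> g" "u \<in> Units B" by (simp_all add: B.m_comm B.Units_closed)
  then have "s \<in> orbit (Gamma A) (Gamma_act A) t"
    unfolding orbit_Gamma[OF tB] using g(1) by blast
  moreover have "t = \<one>\<^bsub>B\<^esub> \<otimes>\<^bsub>B\<^esub> t" using tB by simp
  then have "t \<in> orbit (Gamma A) (Gamma_act A) t"
    unfolding orbit_Gamma[OF tB] using B.Units_one_closed by blast
  ultimately show ?thesis using T W s t unfolding is_transversal_def by blast
qed

lemma polar_class_generate:
  assumes "f \<in> carrier (mult_of B)"
  shows "polar_class A f \<in> generate P (polar_class A ` T)"
  using assms
proof (induction rule: B.factorial_induct)
  case (unit u)
  then show ?case using generate.one[of P] by (simp add: polar_class_Units)
next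
  case (mult f g)
  then show ?case
    using generate.eng[OF mult(3,4)] hom_mult[OF polar_class_hom mult(1,2)] by simp
next
  case (irreducible q)
  interpret P: comm_group P by (rule comm_group_polar_group)
  have q: "q \<in> carrier B" "q \<noteq> \<zero>\<^bsub>B\<^esub>" using irreducible by auto
  have irr: "ring_irreducible\<^bsub>B\<^esub> q" using irreducible by (intro B.ring_irreducibleI') auto
  show ?case
  proof (cases "no_real_divisor A q")
    case True
    then have "q \<in> Delta1 A" using q irr by (simp add: Delta1_def Delta_def)
    then obtain u t where u: "u \<in> Units B" and t: "t \<in> T"
      and tq: "t = u \<otimes>\<^bsub>B\<^esub> q \<or> t = u \<otimes>\<^bsub>B\<^esub> bar q"
      by (rule transversal_exists)
    \<comment> \<open>Replacing \<open>q\<close> by the representative of its orbit costs at most a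
      unit, which is invisible in the class, and a conjugation, which inverts it.\<close>
    have "polar_class A t = polar_class A q \<or> polar_class A t = inv\<^bsub>P\<^esub> polar_class A q"
      using tq polar_class_mult_unit[OF u irreducible(1)]
        polar_class_mult_unit[OF u conjugate_mult_of[OF irreducible(1)]]
        polar_class_conjugate[OF irreducible(1)] by metis
    then have "polar_class A q = polar_class A t \<or> polar_class A q = inv\<^bsub>P\<^esub> polar_class A t"
      using P.inv_inv[OF hom_in_carrier[OF polar_class_hom irreducible(1)]] by metis
    then show ?thesis using t generate.incl[of "polar_class A t" _ P]
        generate.inv[of "polar_class A t" _ P] by (metis imageI)
  next
    case False
    then obtain r where r: "r \<in> carrier A" "r \<noteq> \<zero>" "r \<notin> Units A"
      "q \<in> PIdl\<^bsub>B\<^esub> (of_base A r)"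
      unfolding no_real_divisor_def by auto
    then obtain c where c: "c \<in> carrier B" "q = c \<otimes>\<^bsub>B\<^esub> of_base A r"
      unfolding cgenideal_def by blast
    \<comment> \<open>One factor of the irreducible \<open>q\<close> is a unit of \<open>B\<close>;
      it cannot be the image of \<open>r\<close>, since then \<open>r\<close> would already be a
      unit of \<open>A\<close>.\<close>
    have "c \<in> Units B"
      using B.ring_irreducibleE(5)[OF q(1) irr c(1) A.of_base_closed[OF r(1)] c(2)]
        A.Units_of_base[OF r(1)] r(3) by blast
    then have "polar_class A q = \<one>\<^bsub>P\<^esub>"
      unfolding c(2) using r by (intro polar_class_eq_one) auto
    then show ?thesis using generate.one[of P] by simp
  qed
qed

lemma transversal_basis: "is_basis P (polar_class A ` T)"
proof -
  interpret P: comm_group P by (rule comm_group_polar_group)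
  have TB: "T \<subseteq> carrier (mult_of B)" using transversal_Delta1 Delta1_mult_of(1) by blast
  have S: "polar_class A ` T \<subseteq> carrier P" using hom_in_carrier[OF polar_class_hom] TB by blast
  show ?thesis
  proof (rule P.is_basisI[OF S])
    show "carrier P \<subseteq> generate P (polar_class A ` T)"
    proof
      fix x assume "x \<in> carrier P"
      then obtain f g where fg: "f \<in> carrier (mult_of B)" "g \<in> carrier (mult_of B)"
        "x = polar_class A f \<otimes>\<^bsub>P\<^esub> inv\<^bsub>P\<^esub> polar_class A g"
        by (rule carrier_polar_groupE)
      show "x \<in> generate P (polar_class A ` T)"
        unfolding fg(3)
        by (intro generate.eng P.generate_m_inv_closed[OF S] polar_class_generate fg)
    qed
  next
    fix s assume "s \<in> polar_class A ` T"
    then obtain t where t: "t \<in> T" "s = polar_class A t" by blast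
    have tB: "t \<in> carrier (mult_of B)" using TB t(1) by blast
    obtain w where w: "w \<in> hom P integer_group"
      "\<And>f. f \<in> carrier (mult_of B) \<Longrightarrow> w (polar_class A f) = int (val t f) - int (val (bar t) f)"
      using polar_dual_hom[OF tB] by blast
    have delta: "w (polar_class A r) = (if r = t then 1 else 0)" if r: "r \<in> T" for r
    proof -
      have rB: "r \<in> carrier (mult_of B)" using TB r by blast
      have "\<not> t \<sim>\<^bsub>mult_of B\<^esub> bar t"
        using Delta1_not_associated_conjugate[OF transversal_Delta1[OF t(1)]]
          B.mult_of.associated_sym tB conjugate_mult_of[OF tB] by blast
      \<comment> \<open>By \<open>transversal_unique\<close>, an association of \<open>r\<close>
        with \<open>t\<close> or with \<open>bar t\<close> forces \<open>r = t\<close>; the case of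
        \<open>bar t\<close> would then make \<open>t\<close> associated to its own
        conjugate.\<close>
      then have "val t r = (if r = t then 1 else 0)" "val (bar t) r = 0"
        using B.prime_valuation_irreducible[OF tB rB] t(1) r
          B.prime_valuation_irreducible[OF conjugate_mult_of[OF tB] rB] transversal_unique[OF r t(1)]
          Delta1_mult_of(2)[OF transversal_Delta1[OF r]] B.mult_of.associated_refl[OF tB]
        by auto
      then show ?thesis using w(2)[OF rB] by simp
    qed
    show "\<exists>w \<in> hom P integer_group. \<forall>s' \<in> polar_class A ` T. w s' = (if s' = s then 1 else 0)"
    proof (intro bexI[OF _ w(1)] ballI)
      fix s' assume "s' \<in> polar_class A ` T"
      then obtain r where r: "r \<in> T" "s' = polar_class A r" by blast
      \<comment> \<open>The values of \<open>w\<close> separate the class of \<open>t\<close> from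
        the classes of all other members of \<open>T\<close>, so the dual condition, indexed by
        members of \<open>T\<close>, can be indexed by their classes.\<close>
      have "s' = s \<longleftrightarrow> r = t"
        using delta[OF r(1)] delta[OF t(1)] r(2) t(2) by (auto split: if_splits)
      then show "w s' = (if s' = s then 1 else 0)" using delta[OF r(1)] r(2) by simp
    qed
  qed
qed

end

end

theorem corollary5p6:
  fixes A :: "('a, 'm) ring_scheme" and \<phi> :: "real \<Rightarrow> 'a"
  assumes "noetherian_domain A"
    and "\<phi> \<in> ring_hom ring_of_type_algebra A"
    and "\<And>x. x \<in> carrier A \<Longrightarrow> ring.algebraic A (range \<phi>) x \<Longrightarrow> x \<in> range \<phi>"
    and "domain (complexification A)"
    and "factorial_domain A"
    and "factorial_domain (complexification A)"
  shows "free_abelian (polar_group A) \<and>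
         (\<forall>T. is_transversal A T \<longrightarrow> is_basis (polar_group A) (polar_class A ` T))"
proof -
  interpret A: factorial_domain A by fact
  have \<phi>: "\<phi> r \<in> carrier A" "\<phi> (r + s) = \<phi> r \<oplus>\<^bsub>A\<^esub> \<phi> s" "\<phi> (r * s) = \<phi> r \<otimes>\<^bsub>A\<^esub> \<phi> s" for r s
    using ring_hom_closed[OF assms(2), of r] ring_hom_add[OF assms(2), of r s]
      ring_hom_mult[OF assms(2), of r s]
    by (simp_all add: ring_of_type_algebra_def)
  have "\<phi> 1 = \<one>\<^bsub>A\<^esub>" using ring_hom_one[OF assms(2)] by (simp add: ring_of_type_algebra_def)
  \<comment> \<open>The real number 1/2 supplies the inverse of 2 in \<open>A\<close>.\<close>
  then have "\<one>\<^bsub>A\<^esub> \<oplus>\<^bsub>A\<^esub> \<one>\<^bsub>A\<^esub> = \<phi> 2" "\<phi> 2 \<otimes>\<^bsub>A\<^esub> \<phi> (1/2) = \<one>\<^bsub>A\<^esub>"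
    using \<phi>(2)[of 1 1] \<phi>(3)[of 2 "1/2"] by simp_all
  then have "\<one>\<^bsub>A\<^esub> \<oplus>\<^bsub>A\<^esub> \<one>\<^bsub>A\<^esub> \<in> Units A"
    using A.divides_one[OF \<phi>(1)[of 2]] \<phi>(1) by (metis dividesI)
  then interpret polar_factorial A
    using assms(5,6) by (simp add: polar_factorial_def polar_factorial_axioms_def)
  show ?thesis
    \<comment> \<open>Freeness asks for at least one basis; it comes from the existence of some
      transversal.\<close>
    using transversal_basis comm_group_polar_group A.ex_transversal
    by (auto simp: free_abelian_def)
qed

end
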